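(* Let $\overline{M}_i^u$ and $\overline{M}_j^v$ be simple $\mathrm{u}_q$-modules, with $i,j\in\mathbb{Z}/d\mathbb{Z}$, $0\le u,v\le d-1$ and $u+v\le d-1$. Suppose $v\le u$. There is an isomorphism of $\mathrm{u}_q$-modules $$\overline{M}_i^u\otimes\overline{M}_j^v\cong\bigoplus_{l=0}^{v}\overline{M}_{i+j+l}^{\,u+v-2l}.$$
   Context: Let $q\in\mathbb{C}$ be a primitive $n$-th root of unity with $n\ge 3$, $n\ne 4$, and set $d=n$ if $n$ is odd, $d=n/2$ if $n$ is even. The Hopf algebra $\mathrm{u}_q=\mathrm{u}_q(\mathfrak{sl}_2(\mathbb{C}))$ is the $\mathbb{C}$-algebra generated by $E,F,K$ with relations $E^d=F^d=0$, $K^d=1$, $KE=q^2EK$, $KF=q^{-2}FK$, $EF-FE=\frac{K-K^{-1}}{q-q^{-1}}$, with $\Delta(E)=1\otimes E+E\otimes K$, $\Delta(F)=K^{-1}\otimes F+F\otimes 1$, $\Delta(K)=K\otimes K$. Tensor products are over $\mathbb{C}$, with module structure through $\Delta$. Let $[x]=\frac{q^x-q^{-x}}{q-q^{-1}}$. For $i\in\mathbb{Z}/d\mathbb{Z}$ and $0\le u\le d-1$ with $u\equiv-2i \pmod d$, $\overline{M}_i^u$ denotes the simple $\mathrm{u}_q$-module with $\mathbb{C}$-basis $e_i^0,\dots,e_i^u$ and action $Ke_i^j=q^{2(i+j)}e_i^j$, $Ee_i^j=e_i^{j+1}$ for $0\le j\le u-1$, $Ee_i^u=0$, $Fe_i^0=0$,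 $Fe_i^j=\lambda_i^{j-1}e_i^{j-1}$ for $1\le j\le u$, where $\lambda_i^{j}=-\sum_{h=0}^{j}[2(i+h)]$. These are all the simple $\mathrm{u}_q$-modules up to isomorphism; the symbol $\overline{M}_i^u$ is used only when $u\equiv-2i\pmod d$. *)

theory Defs
  imports
    Complex_Main
    "HOL-Library.Poly_Mapping"
    "HOL-Library.Product_Plus"
    "HOL-Number_Theory.Cong"
    "HOL-Algebra.Module"
    "HOL-Algebra.QuotRing"
    "HOL-Algebra.Algebraic_Closure_Type"
begin

text \<open>The locale \<open>module\<close> of HOL-Algebra assumes a commutative ring of scalars; the following is
  the same list of axioms over an arbitrary ring. The fields \<open>mult\<close> and \<open>one\<close> that the
  record type inherits play no role and are left undefined below.\<close>

locale left_module = R?: ring R + M?: abelian_group M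
  for R :: "('a, 'c) ring_scheme" (structure) and M :: "('a, 'b) module" (structure) +
  assumes lm_smult_closed:
      "\<lbrakk>a \<in> carrier R; x \<in> carrier M\<rbrakk> \<Longrightarrow> a \<odot>\<^bsub>M\<^esub> x \<in> carrier M"
    and lm_smult_l_distr:
      "\<lbrakk>a \<in> carrier R; b \<in> carrier R; x \<in> carrier M\<rbrakk> \<Longrightarrow>
       (a \<oplus>\<^bsub>R\<^esub> b) \<odot>\<^bsub>M\<^esub> x = a \<odot>\<^bsub>M\<^esub> x \<oplus>\<^bsub>M\<^esub> b \<odot>\<^bsub>M\<^esub> x"
    and lm_smult_r_distr:
      "\<lbrakk>a \<in> carrier R; x \<in> carrier M; y \<in> carrier M\<rbrakk> \<Longrightarrow>
       a \<odot>\<^bsub>M\<^esub> (x \<oplus>\<^bsub>M\<^esub> y) = a \<odot>\<^bsub>M\<^esub> x \<oplus>\<^bsub>M\<^esub> a \<odot>\<^bsub>M\<^esub> y"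
    and lm_smult_assoc:
      "\<lbrakk>a \<in> carrier R; b \<in> carrier R; x \<in> carrier M\<rbrakk> \<Longrightarrow>
       (a \<otimes>\<^bsub>R\<^esub> b) \<odot>\<^bsub>M\<^esub> x = a \<odot>\<^bsub>M\<^esub> (b \<odot>\<^bsub>M\<^esub> x)"
    and lm_smult_one: "x \<in> carrier M \<Longrightarrow> \<one>\<^bsub>R\<^esub> \<odot>\<^bsub>M\<^esub> x = x"

definition left_module_hom ::
    "('a, 'c) ring_scheme \<Rightarrow> ('a, 'm) module \<Rightarrow> ('a, 'n) module \<Rightarrow> ('m \<Rightarrow> 'n) set" where
  "left_module_hom R M N =
     {h \<in> carrier M \<rightarrow> carrier N.
        (\<forall>x\<in>carrier M. \<forall>y\<in>carrier M. h (x \<oplus>\<^bsub>M\<^esub> y) = h x \<oplus>\<^bsub>N\<^esub> h y) \<and>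
        (\<forall>a\<in>carrier R. \<forall>x\<in>carrier M. h (a \<odot>\<^bsub>M\<^esub> x) = a \<odot>\<^bsub>N\<^esub> h x)}"

definition left_module_iso ::
    "('a, 'c) ring_scheme \<Rightarrow> ('a, 'm) module \<Rightarrow> ('a, 'n) module \<Rightarrow> bool" where
  "left_module_iso R M N \<longleftrightarrow>
     left_module R M \<and> left_module R N \<and>
     (\<exists>h\<in>left_module_hom R M N. bij_betw h (carrier M) (carrier N))"

definition direct_sum :: "'i set \<Rightarrow> ('i \<Rightarrow> ('a, 'm) module) \<Rightarrow> ('a, 'i \<Rightarrow> 'm) module" where
  "direct_sum I M =
     \<lparr>carrier = {x \<in> \<Pi>\<^sub>E l\<in>I. carrier (M l). finite {l \<in> I. x l \<noteq> \<zero>\<^bsub>M l\<^esub>}},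
      mult = undefined, one = undefined,
      zero = (\<lambda>l\<in>I. \<zero>\<^bsub>M l\<^esub>),
      add = (\<lambda>x y. \<lambda>l\<in>I. x l \<oplus>\<^bsub>M l\<^esub> y l),
      module.smult = (\<lambda>a x. \<lambda>l\<in>I. a \<odot>\<^bsub>M l\<^esub> x l)\<rparr>"

text \<open>Words form a monoid under concatenation, so that \<open>'g list \<Rightarrow>\<^sub>0 complex\<close> with the
  (convolution) product of \<^theory>\<open>HOL-Library.Poly_Mapping\<close> is the free complex
  algebra on \<open>'g\<close>, and \<open>'g list \<times> 'g list \<Rightarrow>\<^sub>0 complex\<close> is its tensor square, the pair
  \<open>(w, w')\<close> standing for \<open>w \<otimes> w'\<close>.\<close>

instantiation list :: (type) monoid_add
begin

definition zero_list_def: "0 = []"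

definition plus_list_def: "xs + ys = xs @ ys"

instance
  by standard (simp_all add: zero_list_def plus_list_def)

end

datatype gen = E | F | K

type_synonym free_alg = "gen list \<Rightarrow>\<^sub>0 complex"

type_synonym free_alg2 = "gen list \<times> gen list \<Rightarrow>\<^sub>0 complex"

definition const :: "complex \<Rightarrow> free_alg" where
  "const c = Poly_Mapping.single [] c"

definition gn :: "gen \<Rightarrow> free_alg" where
  "gn g = Poly_Mapping.single [g] 1"

definition tens :: "gen list \<Rightarrow> gen list \<Rightarrow> free_alg2"  (infix \<open>\<otimes>\<^sub>w\<close> 75) where
  "w \<otimes>\<^sub>w w' = Poly_Mapping.single (w, w') 1"

definition lin_ext :: "('a \<Rightarrow> ('b \<Rightarrow>\<^sub>0 complex)) \<Rightarrow> ('a \<Rightarrow>\<^sub>0 complex) \<Rightarrow> ('b \<Rightarrow>\<^sub>0 complex)" where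
  "lin_ext f z = (\<Sum>x\<in>Poly_Mapping.keys z.
     Poly_Mapping.map ((*) (Poly_Mapping.lookup z x)) (f x))"

definition primitive_root_of_unity :: "nat \<Rightarrow> complex \<Rightarrow> bool" where
  "primitive_root_of_unity n q \<longleftrightarrow> q ^ n = 1 \<and> (\<forall>k. 0 < k \<and> k < n \<longrightarrow> q ^ k \<noteq> 1)"

definition ord_d :: "nat \<Rightarrow> nat" where
  "ord_d n = (if odd n then n else n div 2)"

text \<open>\<open>K\<close> is invertible in the quotient because of the relation \<open>K\<^bsup>d\<^esup> = 1\<close>; its inverse is
  represented by \<open>K\<^bsup>d-1\<^esup>\<close>.\<close>

definition K_inv_word :: "nat \<Rightarrow> gen list" where
  "K_inv_word n = replicate (ord_d n - 1) K"

definition uq_relators :: "complex \<Rightarrow> nat \<Rightarrow> free_alg set" where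
  "uq_relators q n =
     {gn E ^ ord_d n, gn F ^ ord_d n, gn K ^ ord_d n - 1,
      gn K * gn E - const (q powi 2) * gn E * gn K,
      gn K * gn F - const (q powi (-2)) * gn F * gn K,
      gn E * gn F - gn F * gn E
        - const (1 / (q - inverse q)) * (gn K - Poly_Mapping.single (K_inv_word n) 1)}"

abbreviation free_ring :: "free_alg ring" where
  "free_ring \<equiv> ring_of_type_algebra"

definition uq_ideal :: "complex \<Rightarrow> nat \<Rightarrow> free_alg set" where
  "uq_ideal q n = genideal free_ring (uq_relators q n)"

definition uq :: "complex \<Rightarrow> nat \<Rightarrow> free_alg set ring" where
  "uq q n = free_ring Quot uq_ideal q n"

definition uq_class :: "complex \<Rightarrow> nat \<Rightarrow> free_alg \<Rightarrow> free_alg set" where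
  "uq_class q n a = uq_ideal q n +>\<^bsub>free_ring\<^esub> a"

text \<open>The comultiplication, as an algebra homomorphism from the free algebra to its tensor
  square; the comultiplication of \<open>u\<^sub>q\<close> is the map it induces on quotients.\<close>

fun comult_gen :: "nat \<Rightarrow> gen \<Rightarrow> free_alg2" where
  "comult_gen n E = [] \<otimes>\<^sub>w [E] + [E] \<otimes>\<^sub>w [K]"
| "comult_gen n F = K_inv_word n \<otimes>\<^sub>w [F] + [F] \<otimes>\<^sub>w []"
| "comult_gen n K = [K] \<otimes>\<^sub>w [K]"

definition comult :: "nat \<Rightarrow> free_alg \<Rightarrow> free_alg2" where
  "comult n = lin_ext (\<lambda>w. prod_list (map (comult_gen n) w))"

text \<open>The complex vector space underlying a \<open>u\<^sub>q\<close>-module: \<open>c\<close> acts as the scalar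
  \<open>c \<cdot> 1 \<in> u\<^sub>q\<close>.\<close>

definition cscale ::
    "complex \<Rightarrow> nat \<Rightarrow> (free_alg set, 'm) module \<Rightarrow> complex \<Rightarrow> 'm \<Rightarrow> 'm" where
  "cscale q n M c x = uq_class q n (const c) \<odot>\<^bsub>M\<^esub> x"

text \<open>The complex vector space with basis \<open>carrier M \<times> carrier N\<close>, as an additive group.\<close>

definition free_space ::
    "('a, 'm) module \<Rightarrow> ('a, 'n) module \<Rightarrow> ('m \<times> 'n \<Rightarrow>\<^sub>0 complex) ring" where
  "free_space M N =
     \<lparr>carrier = {z. Poly_Mapping.keys z \<subseteq> carrier M \<times> carrier N},
      mult = undefined, one = undefined, zero = 0, add = (+)\<rparr>"

abbreviation pr :: "'m \<Rightarrow> 'n \<Rightarrow> ('m \<times> 'n \<Rightarrow>\<^sub>0 complex)" where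
  "pr x y \<equiv> Poly_Mapping.single (x, y) 1"

definition bilinear_relators ::
    "complex \<Rightarrow> nat \<Rightarrow> (free_alg set, 'm) module \<Rightarrow> (free_alg set, 'n) module \<Rightarrow>
     ('m \<times> 'n \<Rightarrow>\<^sub>0 complex) set" where
  "bilinear_relators q n M N =
     {pr (x \<oplus>\<^bsub>M\<^esub> x') y - pr x y - pr x' y | x x' y.
        x \<in> carrier M \<and> x' \<in> carrier M \<and> y \<in> carrier N} \<union>
     {pr x (y \<oplus>\<^bsub>N\<^esub> y') - pr x y - pr x y' | x y y'.
        x \<in> carrier M \<and> y \<in> carrier N \<and> y' \<in> carrier N} \<union>
     {pr (cscale q n M c x) y - Poly_Mapping.map ((*) c) (pr x y) | c x y.
        x \<in> carrier M \<and> y \<in> carrier N} \<union>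
     {pr x (cscale q n N c y) - Poly_Mapping.map ((*) c) (pr x y) | c x y.
        x \<in> carrier M \<and> y \<in> carrier N}"

definition tensor_kernel ::
    "complex \<Rightarrow> nat \<Rightarrow> (free_alg set, 'm) module \<Rightarrow> (free_alg set, 'n) module \<Rightarrow>
     ('m \<times> 'n \<Rightarrow>\<^sub>0 complex) set" where
  "tensor_kernel q n M N =
     Modules.module.span (\<lambda>c. Poly_Mapping.map ((*) c)) (bilinear_relators q n M N)"

text \<open>\<open>w \<otimes> w'\<close> sends the basis element \<open>(x, y)\<close> to \<open>(w x, w' y)\<close>.\<close>

definition act2 ::
    "complex \<Rightarrow> nat \<Rightarrow> (free_alg set, 'm) module \<Rightarrow> (free_alg set, 'n) module \<Rightarrow>
     free_alg2 \<Rightarrow> ('m \<times> 'n \<Rightarrow>\<^sub>0 complex) \<Rightarrow> ('m \<times> 'n \<Rightarrow>\<^sub>0 complex)" where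
  "act2 q n M N t z =
     lin_ext (\<lambda>(w, w').
       lin_ext (\<lambda>(x, y). pr (uq_class q n (Poly_Mapping.single w 1) \<odot>\<^bsub>M\<^esub> x)
                            (uq_class q n (Poly_Mapping.single w' 1) \<odot>\<^bsub>N\<^esub> y)) z) t"

text \<open>As in the library's \<^const>\<open>rcoset_mult\<close>, the action on cosets is the union over all
  representatives; it is a coset precisely if the result does not depend on them.\<close>

definition tensor_module ::
    "complex \<Rightarrow> nat \<Rightarrow> (free_alg set, 'm) module \<Rightarrow> (free_alg set, 'n) module \<Rightarrow>
     (free_alg set, ('m \<times> 'n \<Rightarrow>\<^sub>0 complex) set) module" where
  "tensor_module q n M N =
     \<lparr>carrier = a_rcosets\<^bsub>free_space M N\<^esub> (tensor_kernel q n M N),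
      mult = undefined, one = undefined,
      zero = tensor_kernel q n M N,
      add = set_add (free_space M N),
      module.smult = (\<lambda>A Z. \<Union>a\<in>A. \<Union>z\<in>Z.
        tensor_kernel q n M N +>\<^bsub>free_space M N\<^esub> act2 q n M N (comult n a) z)\<rparr>"

definition q_int :: "complex \<Rightarrow> int \<Rightarrow> complex" where
  "q_int q x = (q powi x - q powi (- x)) / (q - inverse q)"

definition lam :: "complex \<Rightarrow> int \<Rightarrow> nat \<Rightarrow> complex" where
  "lam q i j = - (\<Sum>h=0..j. q_int q (2 * (i + int h)))"

text \<open>Vectors are coordinate functions with respect to \<open>e\<^sub>i\<^sup>0, \<dots>, e\<^sub>i\<^sup>u\<close>, and
  \<open>bvec j\<close> stands for \<open>e\<^sub>i\<^sup>j\<close>. The index \<open>i\<close> of \<open>\<int>/d\<int>\<close> is given by an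
  integer representative; everything depends on it only through \<open>q\<^bsup>2i\<^esup>\<close>.\<close>

definition bvec :: "nat \<Rightarrow> nat \<Rightarrow> complex" where
  "bvec j = (\<lambda>k. if k = j then 1 else 0)"

fun simple_gen :: "complex \<Rightarrow> int \<Rightarrow> nat \<Rightarrow> gen \<Rightarrow> nat \<Rightarrow> nat \<Rightarrow> complex" where
  "simple_gen q i u K j = (\<lambda>k. q powi (2 * (i + int j)) * bvec j k)"
| "simple_gen q i u E j = (if j < u then bvec (j + 1) else (\<lambda>k. 0))"
| "simple_gen q i u F j = (if j = 0 then (\<lambda>k. 0) else (\<lambda>k. lam q i (j - 1) * bvec (j - 1) k))"

definition simple_gen_op ::
    "complex \<Rightarrow> int \<Rightarrow> nat \<Rightarrow> gen \<Rightarrow> (nat \<Rightarrow> complex) \<Rightarrow> (nat \<Rightarrow> complex)" where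
  "simple_gen_op q i u g x = (\<lambda>k. \<Sum>j=0..u. x j * simple_gen q i u g j k)"

definition simple_op ::
    "complex \<Rightarrow> int \<Rightarrow> nat \<Rightarrow> free_alg \<Rightarrow> (nat \<Rightarrow> complex) \<Rightarrow> (nat \<Rightarrow> complex)" where
  "simple_op q i u a x = (\<lambda>k. \<Sum>w\<in>Poly_Mapping.keys a.
     Poly_Mapping.lookup a w * foldr (simple_gen_op q i u) w x k)"

text \<open>An element of \<open>u\<^sub>q\<close> acts by the common value of its representatives in the free
  algebra.\<close>

definition simple_module ::
    "complex \<Rightarrow> int \<Rightarrow> nat \<Rightarrow> (free_alg set, nat \<Rightarrow> complex) module" where
  "simple_module q i u =
     \<lparr>carrier = {x. \<forall>k>u. x k = 0},
      mult = undefined, one = undefined,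
      zero = (\<lambda>k. 0),
      add = (\<lambda>x y k. x k + y k),
      module.smult = (\<lambda>A x. the_elem ((\<lambda>a. simple_op q i u a x) ` A))\<rparr>"

end

theory Submission
  imports Defs
begin

text \<open>
  Write \<open>V\<close> and \<open>W\<close> for the two simple modules, with bases \<open>e\<^sup>a\<close> (\<open>a \<le> u\<close>) and \<open>f\<^sup>b\<close> (\<open>b \<le> v\<close>),
  and call \<open>a + b\<close> the degree of \<open>e\<^sup>a \<otimes> f\<^sup>b\<close>. On \<open>V \<otimes> W\<close>, the operator \<open>E\<close> raises the degree by one,
  \<open>F\<close> lowers it by one, \<open>K\<close> acts on degree \<open>k\<close> by \<open>q\<^sup>2\<^sup>(\<^sup>i\<^sup>+\<^sup>j\<^sup>+\<^sup>k\<^sup>)\<close>, and \<open>EF - FE\<close> acts on it by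
  \<open>[2(i + j + k)]\<close> (\<open>gen_op_commutator\<close>). The theorem is the Clebsch-Gordan decomposition, and the
  point is that the classical argument survives at a root of unity as long as \<open>u + v < d\<close>: the
  structure constants factor as \<open>\<lambda>\<^sub>c\<^sup>k = - [k + 1] [2c + k]\<close> (\<open>lam_eq\<close>), and \<open>[x]\<close> vanishes only if
  \<open>d\<close> divides \<open>x\<close>, so in a module of highest index \<open>m \<le> d - 1\<close> only the last of
  \<open>\<lambda>\<^sup>0, \<dots>, \<lambda>\<^sup>m\<close> is zero
  (\<open>lam_top_eq_0\<close>, \<open>lam_nonzero\<close>).

  A vector of degree \<open>k\<close> killed by \<open>F\<close> is determined by its coefficient at \<open>e\<^sup>0 \<otimes> f\<^sup>k\<close>, because the
  \<open>\<lambda>\<close> of \<open>V\<close> do not vanish (\<open>F_kernel\<close>). Conversely, as \<open>v \<le> u\<close>, every degree \<open>l \<le> v\<close> carries such a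
  vector \<open>w\<^sub>l\<close> with coefficient \<open>1\<close> there (\<open>lowest\<close>). By the commutation relation, \<open>F\<close> and \<open>K\<close> act on
  the string \<open>w\<^sub>l, E w\<^sub>l, E\<^sup>2 w\<^sub>l, \<dots>\<close> as on the basis of the simple module with lowest weight \<open>i + j + l\<close>.
  With \<open>m = u + v - 2l\<close>, the vector \<open>E\<^sup>m\<^sup>+\<^sup>1 w\<^sub>l\<close> is killed by \<open>F\<close>, since \<open>\<lambda>\<^sup>m = 0\<close>; its degree
  \<open>u + v - l + 1\<close> exceeds \<open>v\<close>, hence it is zero (\<open>string_vanishes\<close>). So the strings define a linear map
  \<open>assemble\<close> from the direct sum to \<open>V \<otimes> W\<close> that commutes with \<open>E\<close>, \<open>F\<close> and \<open>K\<close>.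

  It is injective: applying \<open>F\<close> repeatedly to an element of the kernel yields a relation between the
  \<open>w\<^sub>l\<close>, which have different degrees (\<open>assemble_injective\<close>). It is surjective: in degrees \<open>k \<le> v\<close> one
  lifts along \<open>F\<close> and corrects by a multiple of \<open>w\<^sub>k\<close> (\<open>homogeneous_decomposition\<close>); in particular all
  \<open>e\<^sup>0 \<otimes> f\<^sup>b\<close> are reached, and \<open>E (e\<^sup>a \<otimes> f\<^sup>b)\<close> yields \<open>e\<^sup>a\<^sup>+\<^sup>1 \<otimes> f\<^sup>b\<close> up to vectors with first
  index \<open>a\<close> (\<open>assemble_surjective\<close>).

  The abstract tensor product, a quotient of the space spanned by all pairs of vectors, is identified
  with the coordinate functions on \<open>{0..u} \<times> {0..v}\<close>: the span of the bilinear relators is the kernel of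
  the coordinate map (\<open>tensor_kernel_eq\<close>). An element of \<open>u\<^sub>q\<close> is a coset of the free algebra. That its
  representatives act alike on the direct sum is checked on the relators (\<open>simple_op_relator\<close>); on the
  tensor product it follows from the bijection \<open>assemble\<close>, which also carries the module axioms over
  (\<open>left_module_iso_transport\<close>).
\<close>

section \<open>Linear extension\<close>

text \<open>The value at \<open>p\<close> of the linear extension of \<open>f\<close>. Coordinates
  of every construction below are values of such functionals, so identities between linear maps
  reduce to identities on the basis.\<close>

definition lin_sum :: "('a \<Rightarrow> complex) \<Rightarrow> ('a \<Rightarrow>\<^sub>0 complex) \<Rightarrow> complex" where
  "lin_sum f p = (\<Sum>w\<in>Poly_Mapping.keys p. Poly_Mapping.lookup p w * f w)"

lemma lin_sum_superset:
  assumes "finite A" "Poly_Mapping.keys p \<subseteq> A"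
  shows "lin_sum f p = (\<Sum>w\<in>A. Poly_Mapping.lookup p w * f w)"
  unfolding lin_sum_def using assms
  by (intro sum.mono_neutral_left) (auto simp: in_keys_iff)

lemma lin_sum_zero [simp]: "lin_sum f 0 = 0"
  by (simp add: lin_sum_def)

lemma lin_sum_single [simp]: "lin_sum f (Poly_Mapping.single w c) = c * f w"
  by (simp add: lin_sum_def)

lemma lin_sum_add: "lin_sum f (p + p') = lin_sum f p + lin_sum f p'"
proof -
  let ?A = "Poly_Mapping.keys p \<union> Poly_Mapping.keys p'"
  have "lin_sum f (p + p') = (\<Sum>w\<in>?A. Poly_Mapping.lookup (p + p') w * f w)"
    by (rule lin_sum_superset) (use Poly_Mapping.keys_add[of p p'] in auto)
  moreover have "lin_sum f p = (\<Sum>w\<in>?A. Poly_Mapping.lookup p w * f w)"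
    by (rule lin_sum_superset) auto
  moreover have "lin_sum f p' = (\<Sum>w\<in>?A. Poly_Mapping.lookup p' w * f w)"
    by (rule lin_sum_superset) auto
  ultimately show ?thesis
    by (simp add: lookup_add algebra_simps sum.distrib)
qed

lemma lookup_scale [simp]:
  "Poly_Mapping.lookup (Poly_Mapping.map ((*) c) p) w = (c::complex) * Poly_Mapping.lookup p w"
  by transfer (simp add: when_def)

lemma lin_sum_scale [simp]: "lin_sum f (Poly_Mapping.map ((*) c) p) = c * lin_sum f p"
proof -
  have "lin_sum f (Poly_Mapping.map ((*) c) p) =
      (\<Sum>w\<in>Poly_Mapping.keys p. Poly_Mapping.lookup (Poly_Mapping.map ((*) c) p) w * f w)"
    by (rule lin_sum_superset) (auto simp: in_keys_iff)
  then show ?thesis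
    by (simp add: lin_sum_def sum_distrib_left mult.assoc)
qed

lemma lin_sum_uminus: "lin_sum f (- p) = - lin_sum f p"
  using lin_sum_add[of f p "- p"] by (simp add: add_eq_0_iff)

lemma lin_sum_diff: "lin_sum f (p - p') = lin_sum f p - lin_sum f p'"
  using lin_sum_add[of f p "- p'"] by (simp add: lin_sum_uminus)

lemma lin_sum_fun_add: "lin_sum (\<lambda>w. f w + g w) p = lin_sum f p + lin_sum g p"
  by (simp add: lin_sum_def algebra_simps sum.distrib)

lemma lin_sum_fun_scale: "lin_sum (\<lambda>w. c * f w) p = c * lin_sum f p"
  by (simp add: lin_sum_def sum_distrib_left mult.left_commute)

lemma lin_sum_cong:
  "(\<And>w. w \<in> Poly_Mapping.keys p \<Longrightarrow> f w = g w) \<Longrightarrow> lin_sum f p = lin_sum g p"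
  by (simp add: lin_sum_def)

lemma poly_mapping_single_induct [case_names zero single add]:
  fixes p :: "'a \<Rightarrow>\<^sub>0 'b::comm_monoid_add"
  assumes "P 0" "\<And>w c. P (Poly_Mapping.single w c)" "\<And>p p'. P p \<Longrightarrow> P p' \<Longrightarrow> P (p + p')"
  shows "P p"
proof -
  have "P (\<Sum>w\<in>A. Poly_Mapping.single w (Poly_Mapping.lookup p w))" if "finite A" for A
    using that by induction (auto intro: assms)
  moreover have "(\<Sum>w\<in>Poly_Mapping.keys p. Poly_Mapping.single w (Poly_Mapping.lookup p w)) = p"
    by (rule poly_mapping_eqI)
       (auto simp: lookup_sum lookup_single when_def in_keys_iff sum.delta)
  ultimately show ?thesis
    using finite_keys[of p] by metis
qed

text \<open>The product is the bilinear extension of the monoid operation, hence both sides are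
  bilinear and agree on basis elements.\<close>

lemma lin_sum_mult:
  fixes p p' :: "'a::monoid_add \<Rightarrow>\<^sub>0 complex"
  shows "lin_sum f (p * p') = lin_sum (\<lambda>w. lin_sum (\<lambda>w'. f (w + w')) p') p"
proof (induction p rule: poly_mapping_single_induct)
  case (single w c)
  show ?case
    by (induction p' rule: poly_mapping_single_induct)
       (simp_all add: mult_single lin_sum_add algebra_simps)
qed (simp_all add: lin_sum_add algebra_simps)

lemma lookup_lin_ext:
  "Poly_Mapping.lookup (lin_ext f p) y = lin_sum (\<lambda>x. Poly_Mapping.lookup (f x) y) p"
  by (simp add: lin_ext_def lin_sum_def lookup_sum)

lemma lin_ext_add: "lin_ext f (p + p') = lin_ext f p + lin_ext f p'"
  by (rule poly_mapping_eqI) (simp add: lookup_lin_ext lookup_add lin_sum_add)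

lemma lin_ext_single: "lin_ext f (Poly_Mapping.single w c) = Poly_Mapping.map ((*) c) (f w)"
  by (rule poly_mapping_eqI) (simp add: lookup_lin_ext)

lemma lin_ext_zero [simp]: "lin_ext f 0 = 0"
  by (simp add: lin_ext_def)

lemma lin_sum_lin_ext: "lin_sum g (lin_ext f p) = lin_sum (\<lambda>x. lin_sum g (f x)) p"
  by (induction p rule: poly_mapping_single_induct)
     (simp_all add: lin_ext_add lin_ext_single lin_sum_add)

lemma keys_lin_ext:
  "Poly_Mapping.keys (lin_ext f p) \<subseteq> (\<Union>x\<in>Poly_Mapping.keys p. Poly_Mapping.keys (f x))"
proof
  fix y assume "y \<in> Poly_Mapping.keys (lin_ext f p)"
  then have "(\<Sum>x\<in>Poly_Mapping.keys p. Poly_Mapping.lookup p x * Poly_Mapping.lookup (f x) y) \<noteq> 0"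
    by (simp add: in_keys_iff lookup_lin_ext lin_sum_def)
  then obtain x where "x \<in> Poly_Mapping.keys p" "Poly_Mapping.lookup (f x) y \<noteq> 0"
    by (elim sum.not_neutral_contains_not_neutral) simp
  then show "y \<in> (\<Union>x\<in>Poly_Mapping.keys p. Poly_Mapping.keys (f x))"
    by (auto simp: in_keys_iff)
qed

section \<open>Linear operators on coordinate functions\<close>

definition linear_op :: "(('s \<Rightarrow> complex) \<Rightarrow> ('t \<Rightarrow> complex)) \<Rightarrow> bool" where
  "linear_op A \<longleftrightarrow> (\<forall>x y. A (\<lambda>s. x s + y s) = (\<lambda>t. A x t + A y t)) \<and>
     (\<forall>c x. A (\<lambda>s. c * x s) = (\<lambda>t. c * A x t))"

lemma linear_opI:
  assumes "\<And>x y t. A (\<lambda>s. x s + y s) t = A x t + A y t"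
    and "\<And>c x t. A (\<lambda>s. c * x s) t = c * A x t"
  shows "linear_op A"
  using assms by (auto simp: linear_op_def)

lemma linear_op_add: "linear_op A \<Longrightarrow> A (\<lambda>s. x s + y s) = (\<lambda>t. A x t + A y t)"
  by (simp add: linear_op_def)

lemma linear_op_scale: "linear_op A \<Longrightarrow> A (\<lambda>s. c * x s) = (\<lambda>t. c * A x t)"
  by (simp add: linear_op_def)

lemma linear_op_scale_right: "linear_op A \<Longrightarrow> A (\<lambda>s. x s * c) = (\<lambda>t. A x t * c)"
  using linear_op_scale[of A c x] by (simp add: mult.commute)

lemma linear_op_zero: "linear_op A \<Longrightarrow> A (\<lambda>s. 0) = (\<lambda>t. 0)"
  using linear_op_scale[of A 0 "\<lambda>s. 0"] by simp

lemma linear_op_sum: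
  assumes "linear_op A"
  shows "A (\<lambda>s. \<Sum>i\<in>I. f i s) = (\<lambda>t. \<Sum>i\<in>I. A (f i) t)"
  by (induction I rule: infinite_finite_induct)
     (simp_all add: linear_op_zero[OF assms] linear_op_add[OF assms])

lemma linear_op_lin_sum:
  assumes "linear_op A"
  shows "A (\<lambda>s. lin_sum (\<lambda>w. f w s) p) = (\<lambda>t. lin_sum (\<lambda>w. A (f w) t) p)"
  unfolding lin_sum_def
  by (subst linear_op_sum[OF assms]) (simp add: linear_op_scale[OF assms])

lemma linear_op_diff: "linear_op A \<Longrightarrow> A (\<lambda>s. x s - y s) = (\<lambda>t. A x t - A y t)"
  using linear_op_add[of A x "\<lambda>s. - y s"] linear_op_scale[of A "-1" y] by simp

lemma linear_op_compose: "linear_op A \<Longrightarrow> linear_op B \<Longrightarrow> linear_op (\<lambda>x. A (B x))"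
  by (simp add: linear_op_def)

lemma linear_op_foldr: "(\<And>g. linear_op (A g)) \<Longrightarrow> linear_op (foldr A w)"
proof (induction w)
  case Nil
  then show ?case by (simp add: linear_op_def)
next
  case (Cons g w)
  then show ?case
    using linear_op_compose[of "A g" "foldr A w"] by (simp add: o_def)
qed

section \<open>Algebra actions from monoid actions\<close>

text \<open>An action \<open>\<rho>\<close> of a monoid by linear operators extends to its monoid
  algebra. This covers words acting on a module and pairs of words acting on a tensor
  product.\<close>

definition act_ext ::
    "('a \<Rightarrow> ('s \<Rightarrow> complex) \<Rightarrow> ('s \<Rightarrow> complex)) \<Rightarrow> ('a \<Rightarrow>\<^sub>0 complex) \<Rightarrow>
     ('s \<Rightarrow> complex) \<Rightarrow> ('s \<Rightarrow> complex)" where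
  "act_ext \<rho> p x = (\<lambda>s. lin_sum (\<lambda>w. \<rho> w x s) p)"

lemma act_ext_add: "act_ext \<rho> (p + p') x = (\<lambda>s. act_ext \<rho> p x s + act_ext \<rho> p' x s)"
  by (simp add: act_ext_def lin_sum_add)

lemma act_ext_diff: "act_ext \<rho> (p - p') x = (\<lambda>s. act_ext \<rho> p x s - act_ext \<rho> p' x s)"
  by (simp add: act_ext_def lin_sum_diff)

lemma act_ext_uminus: "act_ext \<rho> (- p) x = (\<lambda>s. - act_ext \<rho> p x s)"
  by (simp add: act_ext_def lin_sum_uminus)

lemma act_ext_zero: "act_ext \<rho> 0 x = (\<lambda>s. 0)"
  by (simp add: act_ext_def)

lemma act_ext_single: "act_ext \<rho> (Poly_Mapping.single w c) x = (\<lambda>s. c * \<rho> w x s)"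
  by (simp add: act_ext_def)

lemma linear_op_act_ext:
  assumes "\<And>w. linear_op (\<rho> w)"
  shows "linear_op (act_ext \<rho> p)"
  by (rule linear_opI)
     (simp_all add: act_ext_def linear_op_add[OF assms] linear_op_scale[OF assms]
        lin_sum_fun_add lin_sum_fun_scale)

lemma act_ext_mult:
  fixes p p' :: "'a::monoid_add \<Rightarrow>\<^sub>0 complex"
  assumes lin: "\<And>w. linear_op (\<rho> w)"
    and hom: "\<And>w w' y. \<rho> (w + w') y = \<rho> w (\<rho> w' y)"
  shows "act_ext \<rho> (p * p') x = act_ext \<rho> p (act_ext \<rho> p' x)"
proof
  fix s
  have "act_ext \<rho> (p * p') x s = lin_sum (\<lambda>w. lin_sum (\<lambda>w'. \<rho> w (\<rho> w' x) s) p') p"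
    by (simp add: act_ext_def lin_sum_mult hom)
  also have "\<dots> = lin_sum (\<lambda>w. \<rho> w (\<lambda>s. lin_sum (\<lambda>w'. \<rho> w' x s) p') s) p"
    by (rule lin_sum_cong) (subst linear_op_lin_sum[OF lin], simp)
  finally show "act_ext \<rho> (p * p') x s = act_ext \<rho> p (act_ext \<rho> p' x) s"
    by (simp add: act_ext_def)
qed

lemma foldr_plus: "foldr A (w + w') x = foldr A w (foldr A w' x)"
  by (simp add: plus_list_def)

lemma one_free_alg: "(1::free_alg) = Poly_Mapping.single [] 1"
  by (simp flip: single_one add: zero_list_def)

lemma gn_power: "gn g ^ m = Poly_Mapping.single (replicate m g) 1"
  by (induction m) (simp_all add: one_free_alg gn_def mult_single plus_list_def)

section \<open>The quotient algebra\<close>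

lemma ring_of_type_algebra_simps [simp]:
  "carrier (ring_of_type_algebra :: 'a::ring_1 ring) = UNIV"
  "mult (ring_of_type_algebra :: 'a ring) = (*)"
  "one (ring_of_type_algebra :: 'a ring) = 1"
  "zero (ring_of_type_algebra :: 'a ring) = 0"
  "add (ring_of_type_algebra :: 'a ring) = (+)"
  by (simp_all add: ring_of_type_algebra_def)

lemma ring_ring_of_type_algebra: "ring (ring_of_type_algebra :: 'a::ring_1 ring)"
proof -
  have "\<exists>y. x + y = 0" for x :: 'a
    by (rule exI[of _ "- x"]) simp
  moreover have "\<exists>y. y + x = 0" for x :: 'a
    by (rule exI[of _ "- x"]) simp
  ultimately show ?thesis
    unfolding ring_of_type_algebra_def
    by unfold_locales (auto simp: algebra_simps Units_def)
qed

lemma ideal_uq_ideal: "ideal (uq_ideal q n) free_ring"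
  unfolding uq_ideal_def
  by (rule ring.genideal_ideal[OF ring_ring_of_type_algebra]) simp

lemma ring_uq: "ring (uq q n)"
  unfolding uq_def by (rule ideal.quotient_is_ring[OF ideal_uq_ideal])

lemma uq_class_eq: "uq_class q n a = {h + a |h. h \<in> uq_ideal q n}"
  by (auto simp: uq_class_def a_r_coset_def')

lemma carrier_uq: "carrier (uq q n) = range (uq_class q n)"
  by (auto simp: uq_def FactRing_def A_RCOSETS_def' uq_class_def)

lemma uq_class_hom: "uq_class q n \<in> ring_hom free_ring (uq q n)"
  using ideal.rcos_ring_hom[OF ideal_uq_ideal, of q n]
  by (simp add: uq_class_def[abs_def] uq_def)

lemma uq_class_mult: "uq_class q n a \<otimes>\<^bsub>uq q n\<^esub> uq_class q n b = uq_class q n (a * b)"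
  using ring_hom_mult[OF uq_class_hom, of a b q n] by simp

lemma uq_class_add: "uq_class q n a \<oplus>\<^bsub>uq q n\<^esub> uq_class q n b = uq_class q n (a + b)"
  using ring_hom_add[OF uq_class_hom, of a b q n] by simp

lemma uq_class_one: "\<one>\<^bsub>uq q n\<^esub> = uq_class q n 1"
  using ring_hom_one[OF uq_class_hom, of q n] by simp

lemma zero_in_uq_ideal: "0 \<in> uq_ideal q n"
  using additive_subgroup.zero_closed[OF ideal.axioms(1)[OF ideal_uq_ideal], of q n] by simp

lemma self_in_uq_class: "a \<in> uq_class q n a"
  using zero_in_uq_ideal[of q n] by (force simp: uq_class_eq)

text \<open>The annihilator of a stable set of vectors is a two-sided ideal, so it contains the
  ideal as soon as it contains the generating relators.\<close>

lemma uq_ideal_annihilates: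
  fixes \<rho> :: "gen list \<Rightarrow> ('s \<Rightarrow> complex) \<Rightarrow> ('s \<Rightarrow> complex)"
  assumes lin: "\<And>w. linear_op (\<rho> w)"
    and hom: "\<And>w w' y. \<rho> (w + w') y = \<rho> w (\<rho> w' y)"
    and stable: "\<And>a x. x \<in> C \<Longrightarrow> act_ext \<rho> a x \<in> C"
    and rel: "\<And>r x. r \<in> uq_relators q n \<Longrightarrow> x \<in> C \<Longrightarrow> act_ext \<rho> r x = (\<lambda>s. 0)"
    and a: "a \<in> uq_ideal q n" and x: "x \<in> C"
  shows "act_ext \<rho> a x = (\<lambda>s. 0)"
proof -
  define J where "J = {a. \<forall>x\<in>C. act_ext \<rho> a x = (\<lambda>s. 0)}"
  note mult = act_ext_mult[of \<rho>, OF lin hom]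
  note linear = linear_op_act_ext[of \<rho>, OF lin]
  interpret ring "free_ring" by (rule ring_ring_of_type_algebra)
  have "ideal J free_ring"
  proof (rule idealI)
    show "subgroup J (add_monoid free_ring)"
    proof (rule add.subgroupI)
      show "\<ominus>\<^bsub>free_ring\<^esub> b \<in> J" if "b \<in> J" for b
      proof -
        have "\<ominus>\<^bsub>free_ring\<^esub> b = - b"
          by (rule minus_equality) simp_all
        then show ?thesis
          using that by (simp add: J_def act_ext_uminus)
      qed
      show "J \<noteq> {}"
        using act_ext_zero by (auto simp: J_def)
    qed (auto simp: J_def act_ext_add)
  next
    fix b c assume b: "b \<in> J"
    show "c \<otimes>\<^bsub>free_ring\<^esub> b \<in> J"
      using b linear_op_zero[OF linear] by (auto simp: J_def mult)
    show "b \<otimes>\<^bsub>free_ring\<^esub> c \<in> J"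
      using b stable by (auto simp: J_def mult)
  qed (rule ring_axioms)
  then have "uq_ideal q n \<subseteq> J"
    unfolding uq_ideal_def by (rule genideal_minimal) (auto simp: J_def rel)
  then show ?thesis
    using a x by (auto simp: J_def)
qed

section \<open>Quantum integers at a root of unity\<close>

locale root_of_unity =
  fixes q :: complex and n :: nat
  assumes n_ge_3: "n \<ge> 3" and n_neq_4: "n \<noteq> 4" and primitive: "primitive_root_of_unity n q"
begin

abbreviation d :: nat where "d \<equiv> ord_d n"

lemma q_nonzero [simp]: "q \<noteq> 0"
proof
  assume "q = 0"
  then have "q ^ n = 0" using n_ge_3 by simp
  moreover have "q ^ n = 1" using primitive by (simp add: primitive_root_of_unity_def)
  ultimately show False by simp
qed

lemma d_ge_3: "d \<ge> 3"
  using n_ge_3 n_neq_4 by (cases "n = 5") (auto simp: ord_d_def elim!: evenE)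

text \<open>Division with remainder reduces the exponent to the range in which primitivity
  applies.\<close>

lemma q_powi_eq_1_iff: "q powi k = 1 \<longleftrightarrow> int n dvd k"
proof -
  define r where "r = nat (k mod int n)"
  have n: "0 < int n" using n_ge_3 by simp
  have "q powi k = q powi (int n * (k div int n) + int r)"
    using n by (simp add: r_def)
  also have "\<dots> = (q powi int n) powi (k div int n) * q ^ r"
    by (simp add: power_int_add power_int_mult)
  also have "q powi int n = 1"
    using primitive by (simp add: primitive_root_of_unity_def)
  finally have "q powi k = q ^ r" by simp
  moreover have "r < n"
    using n by (simp add: r_def nat_less_iff)
  then have "q ^ r = 1 \<longleftrightarrow> r = 0"
    using primitive by (cases "r = 0") (auto simp: primitive_root_of_unity_def)
  moreover have "r = 0 \<longleftrightarrow> int n dvd k"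
    using pos_mod_sign[OF n, of k] unfolding r_def dvd_eq_mod_eq_0 by linarith
  ultimately show ?thesis by simp
qed

text \<open>\<open>d\<close> is the order of \<open>q\<^sup>2\<close>; this is all that the case
  distinction in its definition is for.\<close>

lemma q_powi_double_eq_1_iff: "q powi (2 * k) = 1 \<longleftrightarrow> int d dvd k"
proof (cases "odd n")
  case True
  then have "coprime (int n) 2" by simp
  then show ?thesis
    using True by (simp add: q_powi_eq_1_iff ord_d_def coprime_dvd_mult_right_iff)
next
  case False
  then obtain m where m: "n = 2 * m" by (auto elim: evenE)
  then show ?thesis
    by (simp add: q_powi_eq_1_iff ord_d_def)
qed

lemma q_minus_inverse_nonzero: "q - inverse q \<noteq> 0"
proof
  assume "q - inverse q = 0"
  then have "q * q = 1" by (simp add: field_simps)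
  then have "q powi (2 * 1) = 1" by (simp add: power2_eq_square)
  then have "int d dvd 1" using q_powi_double_eq_1_iff[of 1] by simp
  then show False using d_ge_3 by simp
qed

lemma q_int_eq_0_iff: "q_int q x = 0 \<longleftrightarrow> int d dvd x"
proof -
  have "q_int q x = 0 \<longleftrightarrow> q powi x = q powi (- x)"
    using q_minus_inverse_nonzero by (simp add: q_int_def)
  also have "\<dots> \<longleftrightarrow> q powi x * q powi x = 1"
    by (simp add: power_int_minus field_simps)
  also have "q powi x * q powi x = q powi (2 * x)"
    by (simp flip: power_int_add)
  finally show ?thesis
    by (simp add: q_powi_double_eq_1_iff)
qed

lemma q_int_add:
  "q_int q (x + y) = q powi (- x) * q_int q y + q powi y * q_int q x"
proof -
  have "q powi (- (x + y)) = q powi (- x) * q powi (- y)"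
    by (simp flip: power_int_add)
  then show ?thesis
    by (simp add: q_int_def power_int_add add_divide_distrib[symmetric] right_diff_distrib)
qed

lemma lam_0: "lam q c 0 = - q_int q (2 * c)"
  by (simp add: lam_def)

lemma lam_Suc: "lam q c (Suc k) = lam q c k - q_int q (2 * (c + int (Suc k)))"
  by (simp add: lam_def)

text \<open>The sum telescopes because \<open>[k + 2] [y + 1] - [k + 1] [y] = [y + k + 2]\<close>,
  here with \<open>y = 2c + k\<close>. The factorisation shows at once which structure constants
  vanish.\<close>

lemma lam_eq: "lam q c k = - (q_int q (int k + 1) * q_int q (2 * c + int k))"
proof (induction k)
  case 0
  have "q_int q 1 = 1"
    using q_minus_inverse_nonzero by (simp add: q_int_def power_int_minus)
  then show ?case by (simp add: lam_0)
next
  case (Suc k)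
  define a where "a = q powi int k"
  define b where "b = q powi (2 * c + int k)"
  define s where "s = q - inverse q"
  have nz: "a \<noteq> 0" "b \<noteq> 0" "s \<noteq> 0"
    using q_minus_inverse_nonzero by (simp_all add: a_def b_def s_def)
  have b2: "q powi (2 * c) = b / a"
    by (simp add: a_def b_def power_int_add)
  have *: "q_int q (int k + 1) = (a * q - inverse a * inverse q) / s"
    "q_int q (int (Suc k) + 1) = (a * q * q - inverse a * inverse q * inverse q) / s"
    "q_int q (2 * c + int k) = (b - inverse b) / s"
    "q_int q (2 * c + int (Suc k)) = (b * q - inverse b * inverse q) / s"
    "q_int q (2 * (c + int (Suc k))) =
      (a * b * q * q - inverse a * inverse b * inverse q * inverse q) / s"
  proof -
    have "2 * (c + int (Suc k)) = (2 * c + int k) + int k + 1 + 1" by simp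
    then have e: "q powi (2 * (c + int (Suc k))) = a * b * q * q"
      unfolding a_def b_def by (simp only: power_int_add_1 power_int_add q_nonzero simp_thms mult_ac
          power_int_1_right)
    have "q powi (2 * c + int (Suc k)) = q powi ((2 * c + int k) + 1)"
      by (simp add: algebra_simps)
    then have f: "q powi (2 * c + int (Suc k)) = b * q"
      by (subst (asm) power_int_add) (simp_all add: b_def)
    have g: "q powi (int (Suc k) + 1) = a * q * q" "q powi (int k + 1) = a * q"
      by (simp_all add: a_def power_int_add power2_eq_square)
    show "q_int q (int k + 1) = (a * q - inverse a * inverse q) / s"
      "q_int q (int (Suc k) + 1) = (a * q * q - inverse a * inverse q * inverse q) / s"
      "q_int q (2 * c + int k) = (b - inverse b) / s"
      "q_int q (2 * c + int (Suc k)) = (b * q - inverse b * inverse q) / s"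
      "q_int q (2 * (c + int (Suc k))) =
        (a * b * q * q - inverse a * inverse b * inverse q * inverse q) / s"
      unfolding q_int_def power_int_minus e f g s_def[symmetric] b_def[symmetric]
      by (simp_all add: mult.assoc)
  qed
  have s: "s * q = q * q - 1"
    by (simp add: s_def algebra_simps)
  have "(a * q - inverse a * inverse q) * (b - inverse b) +
      s * (a * b * q * q - inverse a * inverse b * inverse q * inverse q) =
      (a * q * q - inverse a * inverse q * inverse q) * (b * q - inverse b * inverse q)"
    unfolding s_def using nz by (simp add: field_simps)
  then have "(a * q - inverse a * inverse q) / s * ((b - inverse b) / s) +
      (a * b * q * q - inverse a * inverse b * inverse q * inverse q) / s =
      (a * q * q - inverse a * inverse q * inverse q) / s * ((b * q - inverse b * inverse q) / s)"
    (is "?A / s * (?B / s) + ?C / s = ?D / s * (?G / s)")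
  proof -
    assume *: "?A * ?B + s * ?C = ?D * ?G"
    have "?A / s * (?B / s) + ?C / s = (?A * ?B + s * ?C) / (s * s)"
      using nz(3) by (simp add: add_divide_distrib)
    then show ?thesis
      by (simp only: * times_divide_times_eq)
  qed
  then show ?case
    unfolding lam_Suc Suc.IH * by (metis minus_add_distrib uminus_add_conv_diff add.commute)
qed

lemma lam_top_eq_0:
  assumes "[int m = - 2 * c] (mod int d)"
  shows "lam q c m = 0"
proof -
  have "int d dvd 2 * c + int m"
    using assms by (simp add: cong_iff_dvd_diff add.commute)
  then show ?thesis
    by (simp add: lam_eq q_int_eq_0_iff)
qed

text \<open>By the factorisation, \<open>\<lambda>\<^sup>k = 0\<close> would force \<open>d\<close>
  to divide \<open>k + 1\<close> or \<open>m - k\<close>, both of which lie strictly between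
  \<open>0\<close> and \<open>d\<close>.\<close>

lemma lam_nonzero:
  assumes c: "[int m = - 2 * c] (mod int d)" and "m \<le> d - 1" and "k < m"
  shows "lam q c k \<noteq> 0"
proof -
  have "int d dvd int m + 2 * c"
    using c by (simp add: cong_iff_dvd_diff)
  moreover have "\<not> int d dvd int m - int k"
    using assms(2,3) d_ge_3 zdvd_not_zless[of "int m - int k" "int d"] by auto
  ultimately have "\<not> int d dvd 2 * c + int k"
    using dvd_diff[of "int d" "int m + 2 * c" "2 * c + int k"] by auto
  moreover have "\<not> int d dvd int k + 1"
    using assms(2,3) d_ge_3 zdvd_not_zless[of "int k + 1" "int d"] by auto
  ultimately show ?thesis
    by (simp add: lam_eq q_int_eq_0_iff)
qed

text \<open>The scalar by which \<open>EF - FE\<close> acts on the \<open>k\<close>-th basis vector.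
  At \<open>k = 0\<close> the first term is an empty sum; at \<open>k = m\<close> the second one may
  be left out because the structure constant vanishes.\<close>

lemma lam_step:
  assumes "[int m = - 2 * c] (mod int d)" and "k \<le> m"
  shows "(if k = 0 then 0 else lam q c (k - 1)) - (if k < m then lam q c k else 0) =
    q_int q (2 * (c + int k))"
proof -
  have "(if k < m then lam q c k else 0) = lam q c k"
    using assms lam_top_eq_0[OF assms(1)] by (cases "k = m") auto
  then show ?thesis
    by (cases k) (simp_all add: lam_0 lam_Suc)
qed

end

section \<open>The simple modules\<close>

lemma simple_gen_op_K:
  "simple_gen_op q i u K x k = (if k \<le> u then q powi (2 * (i + int k)) * x k else 0)"
proof -
  have "simple_gen_op q i u K x k =
      (\<Sum>j=0..u. if k = j then q powi (2 * (i + int j)) * x j else 0)"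
    unfolding simple_gen_op_def by (rule sum.cong) (auto simp: bvec_def)
  then show ?thesis by (simp add: sum.delta')
qed

lemma simple_gen_op_E:
  "simple_gen_op q i u E x k = (if 0 < k \<and> k \<le> u then x (k - 1) else 0)"
proof -
  have "simple_gen_op q i u E x k = (\<Sum>j=0..u. if k - 1 = j then (if 0 < k \<and> k \<le> u then x j else 0) else 0)"
    unfolding simple_gen_op_def by (rule sum.cong) (auto simp: bvec_def)
  then show ?thesis by (auto simp: sum.delta')
qed

lemma simple_gen_op_F:
  "simple_gen_op q i u F x k = (if k < u then lam q i k * x (k + 1) else 0)"
proof -
  have "simple_gen_op q i u F x k = (\<Sum>j=0..u. if k + 1 = j then lam q i k * x j else 0)"
    unfolding simple_gen_op_def by (rule sum.cong) (auto simp: bvec_def)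
  then show ?thesis by (simp add: sum.delta' Suc_le_eq)
qed

lemmas simple_gen_op_eqs = simple_gen_op_K simple_gen_op_E simple_gen_op_F

lemma linear_simple_gen_op: "linear_op (simple_gen_op q i u g)"
  by (rule linear_opI) (simp_all add: simple_gen_op_def algebra_simps sum.distrib sum_distrib_left)

lemmas linear_simple_word = linear_op_foldr[OF linear_simple_gen_op]

lemma simple_op_eq: "simple_op q i u = act_ext (foldr (simple_gen_op q i u))"
  by (intro ext) (simp add: simple_op_def act_ext_def lin_sum_def)

lemma simple_gen_op_closed: "k > u \<Longrightarrow> simple_gen_op q i u g x k = 0"
  by (cases g) (simp_all add: simple_gen_op_eqs)

lemma simple_word_closed:
  assumes "\<forall>k>u. x k = 0"
  shows "\<forall>k>u. foldr (simple_gen_op q i u) w x k = 0"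
  using assms by (cases w) (simp_all add: simple_gen_op_closed)

lemma simple_op_closed:
  assumes "\<forall>k>u. x k = 0"
  shows "\<forall>k>u. simple_op q i u a x k = 0"
  using simple_word_closed[OF assms] by (simp add: simple_op_eq act_ext_def lin_sum_def)

lemma linear_simple_op: "linear_op (simple_op q i u a)"
  unfolding simple_op_eq by (rule linear_op_act_ext) (rule linear_simple_word)

lemma simple_op_add:
  "simple_op q i u (a + b) x = (\<lambda>k. simple_op q i u a x k + simple_op q i u b x k)"
  by (simp add: simple_op_eq act_ext_add)

lemma simple_op_mult: "simple_op q i u (a * b) x = simple_op q i u a (simple_op q i u b x)"
  unfolding simple_op_eq by (intro act_ext_mult linear_simple_word foldr_plus)

lemma simple_word_E: "k < m \<Longrightarrow> foldr (simple_gen_op q i u) (replicate m E) x k = 0"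
  by (induction m arbitrary: k) (auto simp: simple_gen_op_E)

lemma simple_word_F:
  assumes "\<forall>k>u. x k = 0"
  shows "k + m > u \<Longrightarrow> foldr (simple_gen_op q i u) (replicate m F) x k = 0"
  using assms by (induction m arbitrary: k) (auto simp: simple_gen_op_F)

lemma simple_word_K:
  assumes "\<forall>k>u. x k = 0"
  shows "foldr (simple_gen_op q i u) (replicate m K) x k = (q powi (2 * (i + int k))) ^ m * x k"
  using assms by (induction m) (auto simp: simple_gen_op_K)

context root_of_unity
begin

lemma K_power_d: "(q powi (2 * x)) ^ d = 1"
proof -
  have "(q powi (2 * x)) ^ d = q powi (2 * (int d * x))"
    by (simp add: power_int_mult[symmetric] mult_ac flip: power_int_of_nat)
  then show ?thesis
    using q_powi_double_eq_1_iff[of "int d * x"] by simp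
qed

lemma K_power_inverse: "(q powi (2 * x)) ^ (d - 1) = q powi (- (2 * x))"
proof -
  have "(q powi (2 * x)) ^ (d - 1) * q powi (2 * x) = 1"
    using K_power_d[of x] d_ge_3 power_Suc2[of "q powi (2 * x)" "d - 1"] by simp
  then show ?thesis
    by (simp add: power_int_minus field_simps)
qed

text \<open>On the module, \<open>K\<^sup>d\<^sup>-\<^sup>1\<close> is the inverse of
  \<open>K\<close> because \<open>q\<^sup>2\<^sup>d = 1\<close>.\<close>

lemma simple_word_K_inv:
  assumes "\<forall>k>u. x k = 0"
  shows "foldr (simple_gen_op q i u) (K_inv_word n) x k = q powi (- (2 * (i + int k))) * x k"
  unfolding K_inv_word_def simple_word_K[OF assms] K_power_inverse ..

text \<open>\<open>E\<^sup>d\<close> and \<open>F\<^sup>d\<close> vanish since they shift the index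
  by \<open>d\<close>, which exceeds \<open>u\<close>; the other relations are comparisons of
  scalars, the last one being \<open>lam_step\<close>.\<close>

lemma simple_op_relator:
  assumes u: "u \<le> d - 1" "[int u = - 2 * i] (mod int d)"
    and r: "r \<in> uq_relators q n" and x: "\<forall>k>u. x k = 0"
  shows "simple_op q i u r x = (\<lambda>k. 0)"
proof -
  have ud: "u < d" using u(1) d_ge_3 by simp
  let ?r = "foldr (simple_gen_op q i u)"
  have EF: "?r [E, F] x k - ?r [F, E] x k = q_int q (2 * (i + int k)) * x k" for k
  proof (cases "k \<le> u")
    case True
    then have "?r [E, F] x k - ?r [F, E] x k =
        ((if k = 0 then 0 else lam q i (k - 1)) - (if k < u then lam q i k else 0)) * x k"
      by (auto simp: simple_gen_op_eqs left_diff_distrib)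
    then show ?thesis
      unfolding lam_step[OF u(2) True] .
  next
    case False
    then show ?thesis using x by (simp add: simple_gen_op_eqs)
  qed
  have q2: "q powi (2 + y) = q powi 2 * q powi y" "q powi (y - 2) = q powi (-2) * q powi y" for y
    by (simp_all add: power_int_add power_int_diff power_int_minus field_simps)
  consider "r = gn E ^ d" | "r = gn F ^ d" | "r = gn K ^ d - 1"
    | "r = gn K * gn E - const (q powi 2) * gn E * gn K"
    | "r = gn K * gn F - const (q powi (-2)) * gn F * gn K"
    | "r = gn E * gn F - gn F * gn E
        - const (1 / (q - inverse q)) * (gn K - Poly_Mapping.single (K_inv_word n) 1)"
    using r by (auto simp: uq_relators_def)
  then show ?thesis
  proof cases
    case 1
    have "?r (replicate d E) x k = 0" for k
      using simple_word_E[of k d] simple_word_closed[OF x, of q i "replicate d E"] ud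
      by (cases "k < d") auto
    then show ?thesis
      by (simp add: 1 simple_op_eq gn_power act_ext_single)
  next
    case 2
    have "?r (replicate d F) x k = 0" for k
      by (rule simple_word_F[OF x]) (use ud in simp)
    then show ?thesis
      by (simp add: 2 simple_op_eq gn_power act_ext_single)
  next
    case 3
    have "?r (replicate d K) x k = x k" for k
      unfolding simple_word_K[OF x] K_power_d by simp
    then show ?thesis
      by (simp add: 3 simple_op_eq gn_power act_ext_diff act_ext_single one_free_alg
          del: foldr_replicate)
  next
    case 4
    have "?r [K, E] x k = q powi 2 * ?r [E, K] x k" for k
      by (cases k) (simp_all add: simple_gen_op_eqs algebra_simps q2)
    then show ?thesis
      by (simp add: 4 simple_op_eq gn_def const_def mult_single plus_list_def
          act_ext_diff act_ext_single)
  next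
    case 5
    have "?r [K, F] x k = q powi (-2) * ?r [F, K] x k" for k
    proof -
      have "q powi (2 * (i + int k)) = q powi (-2) * q powi (2 * (i + int (k + 1)))"
        by (simp flip: power_int_add)
      then show ?thesis
        by (simp only: foldr.simps o_def id_def simple_gen_op_F simple_gen_op_K) auto
    qed
    then show ?thesis
      by (simp add: 5 simple_op_eq gn_def const_def mult_single plus_list_def
          act_ext_diff act_ext_single del: foldr.simps)
  next
    case 6
    have K: "?r [K] x k = q powi (2 * (i + int k)) * x k" for k
      using x by (simp add: simple_gen_op_K)
    have "q_int q (2 * (i + int k)) * x k =
        1 / (q - inverse q) * (?r [K] x k - ?r (K_inv_word n) x k)" for k
      unfolding K simple_word_K_inv[OF x] q_int_def
      unfolding left_diff_distrib[symmetric] mult.assoc[symmetric]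
      by (simp only: times_divide_eq_left times_divide_eq_right mult_1)
    then have "?r [E, F] x k - ?r [F, E] x k -
        1 / (q - inverse q) * (?r [K] x k - ?r (K_inv_word n) x k) = 0" for k
      using EF[of k] by (simp only: diff_self)
    moreover have "simple_op q i u r x k = ?r [E, F] x k - ?r [F, E] x k -
        1 / (q - inverse q) * (?r [K] x k - ?r (K_inv_word n) x k)" for k
      by (simp add: 6 simple_op_eq gn_def const_def mult_single plus_list_def right_diff_distrib
          act_ext_diff act_ext_single del: foldr.simps)
    ultimately show ?thesis
      by (intro ext) (simp only:)
  qed
qed

lemma simple_op_ideal:
  assumes u: "u \<le> d - 1" "[int u = - 2 * i] (mod int d)"
    and a: "a \<in> uq_ideal q n" and x: "\<forall>k>u. x k = 0"
  shows "simple_op q i u a x = (\<lambda>k. 0)"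
  unfolding simple_op_eq
proof (rule uq_ideal_annihilates[where \<rho> = "foldr (simple_gen_op q i u)"
      and C = "{x. \<forall>k>u. x k = 0}" and q = q and n = n])
  show "linear_op (foldr (simple_gen_op q i u) w)" for w
    by (rule linear_simple_word)
  show "foldr (simple_gen_op q i u) (w + w') y =
      foldr (simple_gen_op q i u) w (foldr (simple_gen_op q i u) w' y)" for w w' y
    by (rule foldr_plus)
qed (simp_all flip: simple_op_eq add: simple_op_closed simple_op_relator[OF u] a x)

lemma simple_op_class:
  assumes u: "u \<le> d - 1" "[int u = - 2 * i] (mod int d)" and x: "\<forall>k>u. x k = 0"
    and b: "b \<in> uq_class q n a"
  shows "simple_op q i u b x = simple_op q i u a x"
proof -
  obtain h where "h \<in> uq_ideal q n" "b = h + a"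
    using b by (auto simp: uq_class_eq)
  then show ?thesis
    using simple_op_ideal[OF u _ x, of h] simple_op_add[of q i u h a x] by simp
qed

lemma simple_smult:
  assumes u: "u \<le> d - 1" "[int u = - 2 * i] (mod int d)" and x: "\<forall>k>u. x k = 0"
  shows "uq_class q n a \<odot>\<^bsub>simple_module q i u\<^esub> x = simple_op q i u a x"
proof -
  have "the_elem ((\<lambda>b. simple_op q i u b x) ` uq_class q n a) = simple_op q i u a x"
    by (rule the_elem_image_unique) (use self_in_uq_class simple_op_class[OF u x] in blast)+
  then show ?thesis
    by (simp add: simple_module_def)
qed

lemma left_module_simple:
  assumes u: "u \<le> d - 1" "[int u = - 2 * i] (mod int d)"
  shows "left_module (uq q n) (simple_module q i u)"
proof -
  let ?M = "simple_module q i u"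
  have carr: "x \<in> carrier ?M \<longleftrightarrow> (\<forall>k>u. x k = 0)" for x
    by (simp add: simple_module_def)
  have add: "x \<oplus>\<^bsub>?M\<^esub> y = (\<lambda>k. x k + y k)" for x y
    by (simp add: simple_module_def)
  have "abelian_group ?M"
  proof (rule abelian_groupI)
    show "\<exists>y\<in>carrier ?M. y \<oplus>\<^bsub>?M\<^esub> x = \<zero>\<^bsub>?M\<^esub>" if "x \<in> carrier ?M" for x
      using that by (intro bexI[of _ "\<lambda>k. - x k"]) (auto simp: simple_module_def)
  qed (auto simp: simple_module_def algebra_simps)
  moreover have "left_module_axioms (uq q n) ?M"
  proof
    fix A x assume A: "A \<in> carrier (uq q n)" and x: "x \<in> carrier ?M"
    obtain a where a: "A = uq_class q n a" using A by (auto simp: carrier_uq)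
    show "A \<odot>\<^bsub>?M\<^esub> x \<in> carrier ?M"
      using simple_op_closed[of u x q i a] x[unfolded carr] unfolding a carr
      by (simp only: simple_smult[OF u] simp_thms)
    {
      fix y assume "y \<in> carrier ?M"
      then show "A \<odot>\<^bsub>?M\<^esub> (x \<oplus>\<^bsub>?M\<^esub> y) = A \<odot>\<^bsub>?M\<^esub> x \<oplus>\<^bsub>?M\<^esub> A \<odot>\<^bsub>?M\<^esub> y"
        using x linear_op_add[OF linear_simple_op, of q i u a x y]
        by (simp add: a carr add simple_smult[OF u])
    }
    fix B assume B: "B \<in> carrier (uq q n)"
    obtain b where b: "B = uq_class q n b" using B by (auto simp: carrier_uq)
    show "(A \<oplus>\<^bsub>uq q n\<^esub> B) \<odot>\<^bsub>?M\<^esub> x = A \<odot>\<^bsub>?M\<^esub> x \<oplus>\<^bsub>?M\<^esub> B \<odot>\<^bsub>?M\<^esub> x"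
      using x simple_op_add[of q i u a b x]
      by (simp add: a b carr add uq_class_add simple_smult[OF u])
    show "(A \<otimes>\<^bsub>uq q n\<^esub> B) \<odot>\<^bsub>?M\<^esub> x = A \<odot>\<^bsub>?M\<^esub> (B \<odot>\<^bsub>?M\<^esub> x)"
      using x simple_op_closed[of u x q i b]
      by (simp add: a b carr uq_class_mult simple_smult[OF u] simple_op_mult)
  next
    fix x assume "x \<in> carrier ?M"
    then show "\<one>\<^bsub>uq q n\<^esub> \<odot>\<^bsub>?M\<^esub> x = x"
      by (simp add: carr uq_class_one simple_smult[OF u] simple_op_eq one_free_alg act_ext_single)
  qed
  ultimately show ?thesis
    by (intro left_module.intro ring_uq)
qed

end

section \<open>Direct sums and transport of structure\<close>

lemma left_module_direct_sum:
  assumes R: "ring R" and M: "\<And>l. l \<in> I \<Longrightarrow> left_module R (M l)"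
  shows "left_module R (direct_sum I M)"
proof -
  let ?S = "direct_sum I M"
  have simps: "\<And>x. x \<in> carrier ?S \<longleftrightarrow>
      x \<in> (\<Pi>\<^sub>E l\<in>I. carrier (M l)) \<and> finite {l \<in> I. x l \<noteq> \<zero>\<^bsub>M l\<^esub>}"
    "\<And>x y. x \<oplus>\<^bsub>?S\<^esub> y = (\<lambda>l\<in>I. x l \<oplus>\<^bsub>M l\<^esub> y l)"
    "\<zero>\<^bsub>?S\<^esub> = (\<lambda>l\<in>I. \<zero>\<^bsub>M l\<^esub>)" "\<And>a x. a \<odot>\<^bsub>?S\<^esub> x = (\<lambda>l\<in>I. a \<odot>\<^bsub>M l\<^esub> x l)"
    by (simp_all add: direct_sum_def)
  have grp: "abelian_group (M l)" if "l \<in> I" for l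
    using M[OF that] by (rule left_module.axioms)
  note mon = abelian_group.axioms(1)[OF grp]
  note closed = abelian_monoid.a_closed[OF mon] abelian_monoid.zero_closed[OF mon]
    abelian_group.a_inv_closed[OF grp]
  have mem: "\<And>x l. x \<in> carrier ?S \<Longrightarrow> l \<in> I \<Longrightarrow> x l \<in> carrier (M l)"
    by (auto simp: simps)
  have smult_zero: "a \<odot>\<^bsub>M l\<^esub> \<zero>\<^bsub>M l\<^esub> = \<zero>\<^bsub>M l\<^esub>" if "a \<in> carrier R" "l \<in> I" for a l
  proof -
    interpret left_module R "M l" by (rule M[OF that(2)])
    have "a \<odot>\<^bsub>M l\<^esub> \<zero>\<^bsub>M l\<^esub> \<oplus>\<^bsub>M l\<^esub> a \<odot>\<^bsub>M l\<^esub> \<zero>\<^bsub>M l\<^esub> = a \<odot>\<^bsub>M l\<^esub> \<zero>\<^bsub>M l\<^esub>"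
      using lm_smult_r_distr[of a "\<zero>\<^bsub>M l\<^esub>" "\<zero>\<^bsub>M l\<^esub>"] that by simp
    then show ?thesis
      using that lm_smult_closed[of a "\<zero>\<^bsub>M l\<^esub>"]
        M.add.r_cancel_one[of "a \<odot>\<^bsub>M l\<^esub> \<zero>\<^bsub>M l\<^esub>" "a \<odot>\<^bsub>M l\<^esub> \<zero>\<^bsub>M l\<^esub>"] by simp
  qed
  have "abelian_group ?S"
  proof (rule abelian_groupI)
    fix x y assume x: "x \<in> carrier ?S" and y: "y \<in> carrier ?S"
    have "{l \<in> I. x l \<oplus>\<^bsub>M l\<^esub> y l \<noteq> \<zero>\<^bsub>M l\<^esub>} \<subseteq>
        {l \<in> I. x l \<noteq> \<zero>\<^bsub>M l\<^esub>} \<union> {l \<in> I. y l \<noteq> \<zero>\<^bsub>M l\<^esub>}"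
      using abelian_monoid.l_zero[OF mon] closed(2) by auto
    moreover have "finite ({l \<in> I. x l \<noteq> \<zero>\<^bsub>M l\<^esub>} \<union> {l \<in> I. y l \<noteq> \<zero>\<^bsub>M l\<^esub>})"
      using x y by (simp add: simps)
    ultimately have "finite {l \<in> I. x l \<oplus>\<^bsub>M l\<^esub> y l \<noteq> \<zero>\<^bsub>M l\<^esub>}"
      by (rule finite_subset)
    moreover have "{l \<in> I. (x \<oplus>\<^bsub>?S\<^esub> y) l \<noteq> \<zero>\<^bsub>M l\<^esub>} = {l \<in> I. x l \<oplus>\<^bsub>M l\<^esub> y l \<noteq> \<zero>\<^bsub>M l\<^esub>}"
      by (auto simp: simps)
    ultimately show "x \<oplus>\<^bsub>?S\<^esub> y \<in> carrier ?S"
      using mem[OF x] mem[OF y] closed(1) by (simp add: simps)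
    show "x \<oplus>\<^bsub>?S\<^esub> y = y \<oplus>\<^bsub>?S\<^esub> x"
      unfolding simps(2) using mem[OF x] mem[OF y]
      by (intro restrict_ext abelian_monoid.a_comm[OF mon])
    fix z assume z: "z \<in> carrier ?S"
    show "x \<oplus>\<^bsub>?S\<^esub> y \<oplus>\<^bsub>?S\<^esub> z = x \<oplus>\<^bsub>?S\<^esub> (y \<oplus>\<^bsub>?S\<^esub> z)"
      unfolding simps(2) using mem[OF x] mem[OF y] mem[OF z]
      by (intro restrict_ext) (simp add: abelian_monoid.a_assoc[OF mon])
  next
    fix x assume x: "x \<in> carrier ?S"
    show "\<zero>\<^bsub>?S\<^esub> \<oplus>\<^bsub>?S\<^esub> x = x"
    proof -
      have "\<zero>\<^bsub>?S\<^esub> \<oplus>\<^bsub>?S\<^esub> x = restrict x I"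
        unfolding simps(2,3) using mem[OF x]
        by (intro restrict_ext) (simp add: abelian_monoid.l_zero[OF mon])
      also have "\<dots> = x"
        using x PiE_restrict unfolding simps(1) by blast
      finally show ?thesis .
    qed
    let ?y = "\<lambda>l\<in>I. \<ominus>\<^bsub>M l\<^esub> x l"
    have "{l \<in> I. ?y l \<noteq> \<zero>\<^bsub>M l\<^esub>} \<subseteq> {l \<in> I. x l \<noteq> \<zero>\<^bsub>M l\<^esub>}"
    proof safe
      fix l assume l: "l \<in> I" and "?y l \<noteq> \<zero>\<^bsub>M l\<^esub>" "x l = \<zero>\<^bsub>M l\<^esub>"
      then show False
        using abelian_group.minus_equality[OF grp[OF l], of "\<zero>\<^bsub>M l\<^esub>" "\<zero>\<^bsub>M l\<^esub>"]
          abelian_monoid.l_zero[OF mon[OF l]] closed(2)[OF l] by simp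
    qed
    then have "finite {l \<in> I. ?y l \<noteq> \<zero>\<^bsub>M l\<^esub>}"
      by (rule finite_subset) (use x in \<open>simp add: simps\<close>)
    moreover have "?y \<in> (\<Pi>\<^sub>E l\<in>I. carrier (M l))"
      using mem[OF x] closed(3) by simp
    ultimately have "?y \<in> carrier ?S"
      unfolding simps by blast
    moreover have "?y \<oplus>\<^bsub>?S\<^esub> x = \<zero>\<^bsub>?S\<^esub>"
      unfolding simps(2,3) using mem[OF x]
      by (intro restrict_ext) (simp add: abelian_group.l_neg[OF grp])
    ultimately show "\<exists>y\<in>carrier ?S. y \<oplus>\<^bsub>?S\<^esub> x = \<zero>\<^bsub>?S\<^esub>"
      by blast
  next
    show "\<zero>\<^bsub>?S\<^esub> \<in> carrier ?S"
      using closed(2) by (auto simp: simps)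
  qed
  moreover have "left_module_axioms R ?S"
  proof
    fix a x assume a: "a \<in> carrier R" and x: "x \<in> carrier ?S"
    have "{l \<in> I. (a \<odot>\<^bsub>?S\<^esub> x) l \<noteq> \<zero>\<^bsub>M l\<^esub>} \<subseteq> {l \<in> I. x l \<noteq> \<zero>\<^bsub>M l\<^esub>}"
      using smult_zero[OF a] by (auto simp: simps(4))
    then have "finite {l \<in> I. (a \<odot>\<^bsub>?S\<^esub> x) l \<noteq> \<zero>\<^bsub>M l\<^esub>}"
      by (rule finite_subset) (use x in \<open>simp add: simps\<close>)
    moreover have "a \<odot>\<^bsub>?S\<^esub> x \<in> (\<Pi>\<^sub>E l\<in>I. carrier (M l))"
      using mem[OF x] a left_module.lm_smult_closed[OF M] by (simp add: simps(4))
    ultimately show "a \<odot>\<^bsub>?S\<^esub> x \<in> carrier ?S"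
      unfolding simps(1) by blast
    {
      fix y assume y: "y \<in> carrier ?S"
      show "a \<odot>\<^bsub>?S\<^esub> (x \<oplus>\<^bsub>?S\<^esub> y) = a \<odot>\<^bsub>?S\<^esub> x \<oplus>\<^bsub>?S\<^esub> a \<odot>\<^bsub>?S\<^esub> y"
        unfolding simps(2,4) using mem[OF x] mem[OF y] a
        by (intro restrict_ext) (simp add: left_module.lm_smult_r_distr[OF M])
    }
    fix b assume b: "b \<in> carrier R"
    show "(a \<oplus>\<^bsub>R\<^esub> b) \<odot>\<^bsub>?S\<^esub> x = a \<odot>\<^bsub>?S\<^esub> x \<oplus>\<^bsub>?S\<^esub> b \<odot>\<^bsub>?S\<^esub> x"
      unfolding simps(2,4) using mem[OF x] a b
      by (intro restrict_ext) (simp add: left_module.lm_smult_l_distr[OF M])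
    show "(a \<otimes>\<^bsub>R\<^esub> b) \<odot>\<^bsub>?S\<^esub> x = a \<odot>\<^bsub>?S\<^esub> (b \<odot>\<^bsub>?S\<^esub> x)"
      unfolding simps(2,4) using mem[OF x] a b
      by (intro restrict_ext) (simp add: left_module.lm_smult_assoc[OF M])
  next
    fix x assume x: "x \<in> carrier ?S"
    have "\<one>\<^bsub>R\<^esub> \<odot>\<^bsub>?S\<^esub> x = restrict x I"
      unfolding simps(4) using mem[OF x]
      by (intro restrict_ext) (simp add: left_module.lm_smult_one[OF M])
    also have "\<dots> = x"
      using x PiE_restrict unfolding simps(1) by blast
    finally show "\<one>\<^bsub>R\<^esub> \<odot>\<^bsub>?S\<^esub> x = x" .
  qed
  ultimately show ?thesis
    by (intro left_module.intro R)
qed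

text \<open>A bijection that respects the operations carries the module axioms along. This is how
  the tensor product inherits them from the direct sum.\<close>

lemma left_module_iso_transport:
  assumes N: "left_module R N" and bij: "bij_betw g (carrier N) (carrier M)"
    and g_add: "\<And>x y. x \<in> carrier N \<Longrightarrow> y \<in> carrier N \<Longrightarrow> g x \<oplus>\<^bsub>M\<^esub> g y = g (x \<oplus>\<^bsub>N\<^esub> y)"
    and g_zero: "\<zero>\<^bsub>M\<^esub> = g \<zero>\<^bsub>N\<^esub>"
    and g_smult: "\<And>a x. a \<in> carrier R \<Longrightarrow> x \<in> carrier N \<Longrightarrow> a \<odot>\<^bsub>M\<^esub> g x = g (a \<odot>\<^bsub>N\<^esub> x)"
  shows "left_module_iso R M N"
proof -
  interpret left_module R N by (rule N)
  have carr: "carrier M = g ` carrier N"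
    using bij by (simp add: bij_betw_def)
  have "abelian_group M"
  proof (rule abelian_groupI)
    fix x assume "x \<in> carrier M"
    then obtain x' where x': "x = g x'" "x' \<in> carrier N" by (auto simp: carr)
    show "\<exists>y\<in>carrier M. y \<oplus>\<^bsub>M\<^esub> x = \<zero>\<^bsub>M\<^esub>"
      using x' by (intro bexI[of _ "g (\<ominus>\<^bsub>N\<^esub> x')"]) (simp_all add: carr g_add g_zero M.l_neg)
  qed (auto simp: carr g_add g_zero M.add.m_ac)
  moreover have "left_module_axioms R M"
    by unfold_locales
       (auto simp: carr g_add g_smult lm_smult_closed lm_smult_l_distr lm_smult_r_distr
         lm_smult_assoc lm_smult_one)
  ultimately have M: "left_module R M"
    using R.ring_axioms by (intro left_module.intro)
  let ?h = "inv_into (carrier N) g"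
  have inv: "?h (g x) = x" if "x \<in> carrier N" for x
    using bij that by (simp add: bij_betw_def)
  have "?h \<in> left_module_hom R M N"
    unfolding left_module_hom_def
    by (auto simp: carr g_add g_smult inv lm_smult_closed)
  then show ?thesis
    unfolding left_module_iso_def
    using M N bij_betw_inv_into[OF bij] by blast
qed

section \<open>Operators on a tensor product\<close>

definition tens_op ::
    "((nat \<Rightarrow> complex) \<Rightarrow> (nat \<Rightarrow> complex)) \<Rightarrow> ((nat \<Rightarrow> complex) \<Rightarrow> (nat \<Rightarrow> complex)) \<Rightarrow>
     (nat \<times> nat \<Rightarrow> complex) \<Rightarrow> (nat \<times> nat \<Rightarrow> complex)" where
  "tens_op A B t = (\<lambda>(a, b). A (\<lambda>a'. B (\<lambda>b'. t (a', b')) b) a)"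

lemma linear_tens_op:
  assumes "linear_op A" "linear_op B"
  shows "linear_op (tens_op A B)"
  by (rule linear_opI)
     (simp_all add: tens_op_def linear_op_add[OF assms(1)] linear_op_add[OF assms(2)]
       linear_op_scale[OF assms(1)] linear_op_scale[OF assms(2)] split: prod.splits)

text \<open>A word acts by a finite matrix, and a finite sum commutes with every linear operator in
  the other variable.\<close>

lemma simple_word_swap:
  assumes B: "linear_op B"
  shows "foldr (simple_gen_op q i u) w (\<lambda>a'. B (t a') b) a =
    B (\<lambda>b'. foldr (simple_gen_op q i u) w (\<lambda>a'. t a' b') a) b"
proof (induction w arbitrary: a)
  case (Cons g w)
  show ?case
    unfolding foldr.simps o_def simple_gen_op_def[of q i u g]
    by (subst linear_op_sum[OF B]) (simp add: linear_op_scale_right[OF B] Cons.IH)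
qed simp

definition word_pair_op ::
    "complex \<Rightarrow> int \<Rightarrow> nat \<Rightarrow> int \<Rightarrow> nat \<Rightarrow> gen list \<times> gen list \<Rightarrow>
     (nat \<times> nat \<Rightarrow> complex) \<Rightarrow> (nat \<times> nat \<Rightarrow> complex)" where
  "word_pair_op q i u j v p =
     tens_op (foldr (simple_gen_op q i u) (fst p)) (foldr (simple_gen_op q j v) (snd p))"

lemma linear_word_pair_op: "linear_op (word_pair_op q i u j v p)"
  unfolding word_pair_op_def by (intro linear_tens_op linear_simple_word)

text \<open>Operators on different tensor factors commute, so composition is factorwise.\<close>

lemma word_pair_op_plus:
  "word_pair_op q i u j v (p + p') t = word_pair_op q i u j v p (word_pair_op q i u j v p' t)"
proof -
  obtain w w' x x' where p: "p = (w, w')" "p' = (x, x')"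
    by (metis surj_pair)
  have "foldr (simple_gen_op q i u) w (foldr (simple_gen_op q i u) x
        (\<lambda>a'. foldr (simple_gen_op q j v) w' (foldr (simple_gen_op q j v) x' (\<lambda>b'. t (a', b'))) b)) a =
      foldr (simple_gen_op q i u) w (\<lambda>a''. foldr (simple_gen_op q j v) w'
        (\<lambda>b''. foldr (simple_gen_op q i u) x (\<lambda>a'. foldr (simple_gen_op q j v) x' (\<lambda>b'. t (a', b')) b'') a'') b) a"
    for a b
    by (rule arg_cong[of _ _ "\<lambda>f. foldr (simple_gen_op q i u) w f a"])
       (rule ext, rule simple_word_swap[OF linear_simple_word])
  then show ?thesis
    by (simp add: p word_pair_op_def tens_op_def foldr_plus fun_eq_iff)
qed

definition tensor_gen_op ::
    "complex \<Rightarrow> nat \<Rightarrow> int \<Rightarrow> nat \<Rightarrow> int \<Rightarrow> nat \<Rightarrow> gen \<Rightarrow>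
     (nat \<times> nat \<Rightarrow> complex) \<Rightarrow> (nat \<times> nat \<Rightarrow> complex)" where
  "tensor_gen_op q n i u j v g = act_ext (word_pair_op q i u j v) (comult_gen n g)"

lemma linear_tensor_gen_op: "linear_op (tensor_gen_op q n i u j v g)"
  unfolding tensor_gen_op_def by (rule linear_op_act_ext) (rule linear_word_pair_op)

lemma act_ext_word_pair_mult:
  "act_ext (word_pair_op q i u j v) (p * p') t =
    act_ext (word_pair_op q i u j v) p (act_ext (word_pair_op q i u j v) p' t)"
  by (rule act_ext_mult) (rule linear_word_pair_op, rule word_pair_op_plus)

text \<open>As \<open>comult\<close> is multiplicative, the action of the free algebra through it is
  generated by the three operators \<open>tensor_gen_op\<close>.\<close>

lemma act_ext_comult:
  "act_ext (word_pair_op q i u j v) (comult n a) t =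
    act_ext (foldr (tensor_gen_op q n i u j v)) a t"
proof -
  let ?\<rho> = "act_ext (word_pair_op q i u j v)"
  have one: "?\<rho> 1 t = t" for t
  proof -
    have "(1::free_alg2) = Poly_Mapping.single ([], []) 1"
      by (simp flip: single_one add: zero_prod_def zero_list_def)
    then have "?\<rho> 1 t = ?\<rho> (Poly_Mapping.single ([], []) 1) t"
      by (rule arg_cong)
    then show ?thesis
      by (simp add: act_ext_single word_pair_op_def tens_op_def)
  qed
  have word: "?\<rho> (prod_list (map (comult_gen n) w)) t = foldr (tensor_gen_op q n i u j v) w t" for w t
    by (induction w) (simp_all add: one act_ext_word_pair_mult tensor_gen_op_def)
  have "?\<rho> (comult n a) t s =
      lin_sum (\<lambda>w. ?\<rho> (prod_list (map (comult_gen n) w)) t s) a" for s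
    by (simp add: act_ext_def comult_def lin_sum_lin_ext)
  then show ?thesis
    by (auto simp: word act_ext_def[of "foldr _"])
qed

section \<open>Coordinates on the tensor product\<close>

text \<open>The coordinate of \<open>x \<otimes> y\<close> at \<open>e\<^sup>a \<otimes>
  f\<^sup>b\<close> is \<open>x a * y b\<close>; this is its linear extension.\<close>

definition tensor_coords ::
    "((nat \<Rightarrow> complex) \<times> (nat \<Rightarrow> complex) \<Rightarrow>\<^sub>0 complex) \<Rightarrow> nat \<times> nat \<Rightarrow> complex" where
  "tensor_coords z = (\<lambda>(a, b). lin_sum (\<lambda>(x, y). x a * y b) z)"

lemma tensor_coords_add: "tensor_coords (z + z') = (\<lambda>s. tensor_coords z s + tensor_coords z' s)"
  by (auto simp: tensor_coords_def lin_sum_add)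

lemma tensor_coords_diff: "tensor_coords (z - z') = (\<lambda>s. tensor_coords z s - tensor_coords z' s)"
  by (auto simp: tensor_coords_def lin_sum_diff)

lemma tensor_coords_scale:
  "tensor_coords (Poly_Mapping.map ((*) c) z) = (\<lambda>s. c * tensor_coords z s)"
  by (auto simp: tensor_coords_def)

lemma tensor_coords_zero: "tensor_coords 0 = (\<lambda>s. 0)"
  by (auto simp: tensor_coords_def)

lemma tensor_coords_single: "tensor_coords (Poly_Mapping.single (x, y) c) (a, b) = c * (x a * y b)"
  by (simp add: tensor_coords_def)

lemma tensor_coords_sum: "tensor_coords (\<Sum>i\<in>I. f i) = (\<lambda>s. \<Sum>i\<in>I. tensor_coords (f i) s)"
  by (induction I rule: infinite_finite_induct) (simp_all add: tensor_coords_zero tensor_coords_add)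

interpretation poly_mapping_space:
  Modules.module "\<lambda>c. Poly_Mapping.map ((*) (c::complex)) :: ('a \<Rightarrow>\<^sub>0 complex) \<Rightarrow> ('a \<Rightarrow>\<^sub>0 complex)"
  by (rule Modules.module.intro; rule poly_mapping_eqI) (simp_all add: lookup_add algebra_simps)

lemma poly_mapping_eq_sum_keys:
  "z = (\<Sum>k\<in>Poly_Mapping.keys z. Poly_Mapping.map ((*) (Poly_Mapping.lookup z k)) (Poly_Mapping.single k (1::complex)))"
  by (rule poly_mapping_eqI)
     (auto simp: lookup_sum lookup_single when_def in_keys_iff if_distrib sum.delta' cong: if_cong)

lemma keys_diff: "Poly_Mapping.keys (z - z' :: 'a \<Rightarrow>\<^sub>0 complex) \<subseteq> Poly_Mapping.keys z \<union> Poly_Mapping.keys z'"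
  by (auto simp: in_keys_iff lookup_minus)

lemma keys_scale: "Poly_Mapping.keys (Poly_Mapping.map ((*) (c::complex)) z) \<subseteq> Poly_Mapping.keys z"
  by (auto simp: in_keys_iff)

text \<open>A map that is linear modulo a subspace \<open>S\<close> is determined modulo
  \<open>S\<close> by its values on the basis. It is applied to each argument of a pair in turn,
  \<open>S\<close> being spanned by the bilinear relators.\<close>

lemma linear_mod_subspace:
  fixes f :: "(nat \<Rightarrow> complex) \<Rightarrow> ('a \<Rightarrow>\<^sub>0 complex)"
  assumes S: "poly_mapping_space.subspace S"
    and add: "\<And>x y. \<forall>k>u. x k = 0 \<Longrightarrow> \<forall>k>u. y k = 0 \<Longrightarrow> f (\<lambda>k. x k + y k) - f x - f y \<in> S"
    and scale: "\<And>c x. \<forall>k>u. x k = 0 \<Longrightarrow>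
      f (\<lambda>k. c * x k) - Poly_Mapping.map ((*) c) (f x) \<in> S"
    and x: "\<forall>k>u. x k = 0"
  shows "f x - (\<Sum>a=0..u. Poly_Mapping.map ((*) (x a)) (f (bvec a))) \<in> S"
proof -
  have "f (\<lambda>k. \<Sum>a\<in>A. x a * bvec a k) - (\<Sum>a\<in>A. Poly_Mapping.map ((*) (x a)) (f (bvec a))) \<in> S"
    if "finite A" "A \<subseteq> {0..u}" for A
    using that
  proof (induction A)
    case empty
    show ?case
      using scale[of "\<lambda>k. 0" 0] by simp
  next
    case (insert a A)
    let ?r = "\<lambda>k. \<Sum>a\<in>A. x a * bvec a k"
    have 1: "f (\<lambda>k. x a * bvec a k + ?r k) - f (\<lambda>k. x a * bvec a k) - f ?r \<in> S"
      by (rule add) (use insert.prems in \<open>auto simp: bvec_def intro!: sum.neutral\<close>)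
    have 2: "f (\<lambda>k. x a * bvec a k) - Poly_Mapping.map ((*) (x a)) (f (bvec a)) \<in> S"
      by (rule scale) (use insert.prems in \<open>auto simp: bvec_def\<close>)
    have 3: "f ?r - (\<Sum>a\<in>A. Poly_Mapping.map ((*) (x a)) (f (bvec a))) \<in> S"
      using insert by auto
    show ?case
      using poly_mapping_space.subspace_add[OF S poly_mapping_space.subspace_add[OF S 1 2] 3] insert.hyps
      by (simp add: diff_diff_eq)
  qed
  from this[of "{0..u}"] have
    "f (\<lambda>k. \<Sum>a=0..u. x a * bvec a k) - (\<Sum>a=0..u. Poly_Mapping.map ((*) (x a)) (f (bvec a))) \<in> S"
    by simp
  moreover have "(\<lambda>k. \<Sum>a=0..u. x a * bvec a k) = x"
    using x by (auto simp: bvec_def if_distrib sum.delta' cong: if_cong)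
  ultimately show ?thesis
    by simp
qed

locale simple_pair = root_of_unity +
  fixes u v :: nat and i j :: int
  assumes u_le: "u \<le> d - 1" and cong_u: "[int u = - 2 * i] (mod int d)"
    and v_le: "v \<le> d - 1" and cong_v: "[int v = - 2 * j] (mod int d)"
begin

abbreviation V :: "(free_alg set, nat \<Rightarrow> complex) module" where "V \<equiv> simple_module q i u"
abbreviation W :: "(free_alg set, nat \<Rightarrow> complex) module" where "W \<equiv> simple_module q j v"

lemma in_V_iff: "x \<in> carrier V \<longleftrightarrow> (\<forall>k>u. x k = 0)"
  by (simp add: simple_module_def)

lemma in_W_iff: "x \<in> carrier W \<longleftrightarrow> (\<forall>k>v. x k = 0)"
  by (simp add: simple_module_def)

lemma cscale_V: "x \<in> carrier V \<Longrightarrow> cscale q n V c x = (\<lambda>k. c * x k)"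
  by (simp add: cscale_def in_V_iff simple_smult[OF u_le cong_u] simple_op_eq const_def act_ext_single)

lemma cscale_W: "x \<in> carrier W \<Longrightarrow> cscale q n W c x = (\<lambda>k. c * x k)"
  by (simp add: cscale_def in_W_iff simple_smult[OF v_le cong_v] simple_op_eq const_def act_ext_single)

lemma add_V: "x \<oplus>\<^bsub>V\<^esub> y = (\<lambda>k. x k + y k)" and add_W: "x \<oplus>\<^bsub>W\<^esub> y = (\<lambda>k. x k + y k)"
  by (simp_all add: simple_module_def)

lemma bilinear_relators_sound:
  assumes "r \<in> bilinear_relators q n V W"
  shows "Poly_Mapping.keys r \<subseteq> carrier V \<times> carrier W" "tensor_coords r = (\<lambda>s. 0)"
proof -
  consider (1) x x' y where "r = pr (\<lambda>k. x k + x' k) y - pr x y - pr x' y"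
      "x \<in> carrier V" "x' \<in> carrier V" "y \<in> carrier W"
    | (2) x y y' where "r = pr x (\<lambda>k. y k + y' k) - pr x y - pr x y'"
      "x \<in> carrier V" "y \<in> carrier W" "y' \<in> carrier W"
    | (3) c x y where "r = pr (\<lambda>k. c * x k) y - Poly_Mapping.map ((*) c) (pr x y)"
      "x \<in> carrier V" "y \<in> carrier W"
    | (4) c x y where "r = pr x (\<lambda>k. c * y k) - Poly_Mapping.map ((*) c) (pr x y)"
      "x \<in> carrier V" "y \<in> carrier W"
    using assms unfolding bilinear_relators_def add_V add_W
    by (auto simp: cscale_V cscale_W)
  then have "Poly_Mapping.keys r \<subseteq> carrier V \<times> carrier W \<and> tensor_coords r = (\<lambda>s. 0)"
  proof cases
    case 1
    have "(\<lambda>k. x k + x' k) \<in> carrier V" using 1 by (simp add: in_V_iff)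
    then have "Poly_Mapping.keys r \<subseteq> carrier V \<times> carrier W"
      using 1 by (auto dest!: subsetD[OF keys_diff] split: if_splits)
    then show ?thesis
      by (auto simp: 1 tensor_coords_diff tensor_coords_single distrib_right)
  next
    case 2
    have "(\<lambda>k. y k + y' k) \<in> carrier W" using 2 by (simp add: in_W_iff)
    then have "Poly_Mapping.keys r \<subseteq> carrier V \<times> carrier W"
      using 2 by (auto dest!: subsetD[OF keys_diff] split: if_splits)
    then show ?thesis
      by (auto simp: 2 tensor_coords_diff tensor_coords_single distrib_left)
  next
    case 3
    have "(\<lambda>k. c * x k) \<in> carrier V" using 3 by (simp add: in_V_iff)
    then have "Poly_Mapping.keys r \<subseteq> carrier V \<times> carrier W"
      using 3 by (auto dest!: subsetD[OF keys_diff] split: if_splits)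
    then show ?thesis
      by (auto simp: 3 tensor_coords_diff tensor_coords_single)
  next
    case 4
    have "(\<lambda>k. c * y k) \<in> carrier W" using 4 by (simp add: in_W_iff)
    then have "Poly_Mapping.keys r \<subseteq> carrier V \<times> carrier W"
      using 4 by (auto dest!: subsetD[OF keys_diff] split: if_splits)
    then show ?thesis
      by (auto simp: 4 tensor_coords_diff tensor_coords_single)
  qed
  then show "Poly_Mapping.keys r \<subseteq> carrier V \<times> carrier W" "tensor_coords r = (\<lambda>s. 0)"
    by auto
qed

lemma bilinear_relators_intros:
  assumes "x \<in> carrier V" "y \<in> carrier W"
  shows "x' \<in> carrier V \<Longrightarrow> pr (\<lambda>k. x k + x' k) y - pr x y - pr x' y \<in> bilinear_relators q n V W"
    and "y' \<in> carrier W \<Longrightarrow> pr x (\<lambda>k. y k + y' k) - pr x y - pr x y' \<in> bilinear_relators q n V W"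
    and "pr (\<lambda>k. c * x k) y - Poly_Mapping.map ((*) c) (pr x y) \<in> bilinear_relators q n V W"
    and "pr x (\<lambda>k. c * y k) - Poly_Mapping.map ((*) c) (pr x y) \<in> bilinear_relators q n V W"
proof -
  show "x' \<in> carrier V \<Longrightarrow> pr (\<lambda>k. x k + x' k) y - pr x y - pr x' y \<in> bilinear_relators q n V W"
    unfolding bilinear_relators_def add_V add_W using assms by blast
  show "y' \<in> carrier W \<Longrightarrow> pr x (\<lambda>k. y k + y' k) - pr x y - pr x y' \<in> bilinear_relators q n V W"
    unfolding bilinear_relators_def add_V add_W using assms by blast
  show "pr (\<lambda>k. c * x k) y - Poly_Mapping.map ((*) c) (pr x y) \<in> bilinear_relators q n V W"
    unfolding bilinear_relators_def cscale_V[OF assms(1), symmetric] using assms by blast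
  show "pr x (\<lambda>k. c * y k) - Poly_Mapping.map ((*) c) (pr x y) \<in> bilinear_relators q n V W"
    unfolding bilinear_relators_def cscale_W[OF assms(2), symmetric] using assms by blast
qed

text \<open>Expand the first argument in the basis, then the second one.\<close>

lemma pure_tensor_expansion:
  assumes x: "x \<in> carrier V" and y: "y \<in> carrier W"
  shows "pr x y - (\<Sum>a=0..u. \<Sum>b=0..v. Poly_Mapping.map ((*) (x a * y b)) (pr (bvec a) (bvec b)))
    \<in> tensor_kernel q n V W"
proof -
  define S where "S = tensor_kernel q n V W"
  have S: "poly_mapping_space.subspace S"
    by (simp add: S_def tensor_kernel_def poly_mapping_space.subspace_span)
  have rel: "r \<in> S" if "r \<in> bilinear_relators q n V W" for r
    using that by (simp add: S_def tensor_kernel_def poly_mapping_space.span_base)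
  have 1: "pr x y - (\<Sum>a=0..u. Poly_Mapping.map ((*) (x a)) (pr (bvec a) y)) \<in> S"
    by (rule linear_mod_subspace[where f = "\<lambda>x. pr x y", OF S])
       (use x y bilinear_relators_intros in \<open>auto intro!: rel simp: in_V_iff\<close>)
  have 2: "pr (bvec a) y - (\<Sum>b=0..v. Poly_Mapping.map ((*) (y b)) (pr (bvec a) (bvec b))) \<in> S"
    if "a \<le> u" for a
    by (rule linear_mod_subspace[where f = "\<lambda>y. pr (bvec a) y", OF S])
       (use that y bilinear_relators_intros in \<open>auto intro!: rel simp: in_V_iff in_W_iff bvec_def\<close>)
  have "(\<Sum>a=0..u. Poly_Mapping.map ((*) (x a))
      (pr (bvec a) y - (\<Sum>b=0..v. Poly_Mapping.map ((*) (y b)) (pr (bvec a) (bvec b))))) \<in> S"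
    by (intro poly_mapping_space.subspace_sum[OF S] poly_mapping_space.subspace_scale[OF S] 2) simp
  from poly_mapping_space.subspace_add[OF S 1 this] show ?thesis
    unfolding S_def
    by (simp add: poly_mapping_space.scale_right_diff_distrib sum_subtractf
        poly_mapping_space.scale_sum_right)
qed

text \<open>The relators have zero coordinates. Conversely, modulo the relators every element equals
  the combination of basis pairs given by its coordinates.\<close>

lemma tensor_kernel_eq:
  "tensor_kernel q n V W =
    {z. Poly_Mapping.keys z \<subseteq> carrier V \<times> carrier W \<and> tensor_coords z = (\<lambda>s. 0)}"
proof (intro Set.set_eqI iffI)
  fix z assume "z \<in> tensor_kernel q n V W"
  then have "z \<in> poly_mapping_space.span (bilinear_relators q n V W)"
    by (simp add: tensor_kernel_def)
  then show "z \<in> {z. Poly_Mapping.keys z \<subseteq> carrier V \<times> carrier W \<and> tensor_coords z = (\<lambda>s. 0)}"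
  proof (induction rule: poly_mapping_space.span_induct_alt)
    case (step c r z)
    have "Poly_Mapping.keys (Poly_Mapping.map ((*) c) r + z) \<subseteq> Poly_Mapping.keys r \<union> Poly_Mapping.keys z"
      using keys_add[of "Poly_Mapping.map ((*) c) r" z] keys_scale[of c r] by blast
    then show ?case
      using step bilinear_relators_sound[of r]
      by (auto simp: tensor_coords_add tensor_coords_scale)
  qed (simp add: tensor_coords_zero)
next
  fix z assume "z \<in> {z. Poly_Mapping.keys z \<subseteq> carrier V \<times> carrier W \<and> tensor_coords z = (\<lambda>s. 0)}"
  then have keys: "Poly_Mapping.keys z \<subseteq> carrier V \<times> carrier W" and z: "tensor_coords z = (\<lambda>s. 0)"
    by auto
  have S: "poly_mapping_space.subspace (tensor_kernel q n V W)"
    by (simp add: tensor_kernel_def poly_mapping_space.subspace_span)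
  let ?e = "\<lambda>p. \<Sum>a=0..u. \<Sum>b=0..v. Poly_Mapping.map ((*) (fst p a * snd p b)) (pr (bvec a) (bvec b))"
  have "Poly_Mapping.single p 1 - ?e p \<in> tensor_kernel q n V W" if "p \<in> Poly_Mapping.keys z" for p
    using pure_tensor_expansion[of "fst p" "snd p"] keys that by auto
  then have "(\<Sum>p\<in>Poly_Mapping.keys z. Poly_Mapping.map ((*) (Poly_Mapping.lookup z p))
      (Poly_Mapping.single p 1 - ?e p)) \<in> tensor_kernel q n V W"
    by (intro poly_mapping_space.subspace_sum[OF S] poly_mapping_space.subspace_scale[OF S])
  also have "(\<Sum>p\<in>Poly_Mapping.keys z. Poly_Mapping.map ((*) (Poly_Mapping.lookup z p))
      (Poly_Mapping.single p 1 - ?e p)) =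
      z - (\<Sum>p\<in>Poly_Mapping.keys z. Poly_Mapping.map ((*) (Poly_Mapping.lookup z p)) (?e p))"
    unfolding poly_mapping_space.scale_right_diff_distrib sum_subtractf
    by (subst (4) poly_mapping_eq_sum_keys[of z]) (rule refl)
  also have "(\<Sum>p\<in>Poly_Mapping.keys z. Poly_Mapping.map ((*) (Poly_Mapping.lookup z p)) (?e p)) =
      (\<Sum>a=0..u. \<Sum>b=0..v. Poly_Mapping.map ((*) (tensor_coords z (a, b))) (pr (bvec a) (bvec b)))"
    unfolding poly_mapping_space.scale_sum_right
    by (subst sum.swap, rule sum.cong[OF refl], subst sum.swap, rule sum.cong[OF refl])
       (simp add: tensor_coords_def lin_sum_def case_prod_beta poly_mapping_space.scale_sum_left)
  also have "\<dots> = 0"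
    by (simp add: z)
  finally show "z \<in> tensor_kernel q n V W" by simp
qed

section \<open>The tensor product module\<close>

text \<open>The element of the quotient with coordinates \<open>t\<close>.\<close>

definition tensor_class ::
    "(nat \<times> nat \<Rightarrow> complex) \<Rightarrow> ((nat \<Rightarrow> complex) \<times> (nat \<Rightarrow> complex) \<Rightarrow>\<^sub>0 complex) set" where
  "tensor_class t = {z. Poly_Mapping.keys z \<subseteq> carrier V \<times> carrier W \<and> tensor_coords z = t}"

definition tensor_vectors :: "(nat \<times> nat \<Rightarrow> complex) set" where
  "tensor_vectors = {t. \<forall>a b. u < a \<or> v < b \<longrightarrow> t (a, b) = 0}"

abbreviation gen_op :: "gen \<Rightarrow> (nat \<times> nat \<Rightarrow> complex) \<Rightarrow> (nat \<times> nat \<Rightarrow> complex)" where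
  "gen_op \<equiv> tensor_gen_op q n i u j v"

lemma tensor_coset:
  assumes z: "Poly_Mapping.keys z \<subseteq> carrier V \<times> carrier W"
  shows "tensor_kernel q n V W +>\<^bsub>free_space V W\<^esub> z = tensor_class (tensor_coords z)"
proof (intro Set.set_eqI iffI)
  fix y assume "y \<in> tensor_kernel q n V W +>\<^bsub>free_space V W\<^esub> z"
  then obtain k where "k \<in> tensor_kernel q n V W" "y = k + z"
    by (auto simp: a_r_coset_def' free_space_def)
  then show "y \<in> tensor_class (tensor_coords z)"
    using z keys_add[of k z]
    by (auto simp: tensor_kernel_eq tensor_class_def tensor_coords_add)
next
  fix y assume "y \<in> tensor_class (tensor_coords z)"
  then have "y - z \<in> tensor_kernel q n V W"
    using z keys_diff[of y z]
    by (auto simp: tensor_kernel_eq tensor_class_def tensor_coords_diff)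
  then show "y \<in> tensor_kernel q n V W +>\<^bsub>free_space V W\<^esub> z"
    by (auto simp: a_r_coset_def' free_space_def intro!: bexI[of _ "y - z"])
qed

lemma tensor_class_nonempty:
  assumes "t \<in> tensor_vectors"
  obtains z where "z \<in> tensor_class t"
proof -
  let ?z = "\<Sum>a=0..u. \<Sum>b=0..v. Poly_Mapping.single (bvec a, bvec b) (t (a, b))"
  have "tensor_coords ?z (a', b') = t (a', b')" for a' b'
  proof -
    have "tensor_coords ?z (a', b') = (\<Sum>a=0..u. \<Sum>b=0..v. if b' = b then if a' = a then t (a, b) else 0 else 0)"
      unfolding tensor_coords_sum tensor_coords_single by (intro sum.cong refl) (simp add: bvec_def)
    also have "\<dots> = t (a', b')"
      using assms by (cases "b' \<le> v") (auto simp: sum.delta' tensor_vectors_def not_le)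
    finally show ?thesis .
  qed
  moreover have "Poly_Mapping.keys ?z \<subseteq> carrier V \<times> carrier W"
    by (intro order_trans[OF keys_sum] UN_least) (auto simp: in_V_iff in_W_iff bvec_def split: if_splits)
  moreover from calculation(1) have "tensor_coords ?z = t"
    by (intro ext) (auto simp only: split_paired_all)
  ultimately show thesis
    using that[of ?z] by (simp add: tensor_class_def)
qed

lemma tensor_coords_in_vectors:
  assumes "Poly_Mapping.keys z \<subseteq> carrier V \<times> carrier W"
  shows "tensor_coords z \<in> tensor_vectors"
  using assms
  by (auto simp: tensor_vectors_def tensor_coords_def lin_sum_def in_V_iff in_W_iff subset_iff
      intro!: sum.neutral)

lemma carrier_tensor_module:
  "carrier (tensor_module q n V W) = tensor_class ` tensor_vectors"
proof -
  have "carrier (tensor_module q n V W) =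
      (\<lambda>z. tensor_class (tensor_coords z)) ` {z. Poly_Mapping.keys z \<subseteq> carrier V \<times> carrier W}"
    by (auto simp: tensor_module_def A_RCOSETS_def' free_space_def tensor_coset[unfolded free_space_def])
  also have "\<dots> = tensor_class ` tensor_vectors"
  proof (intro Set.set_eqI iffI)
    fix Z assume "Z \<in> tensor_class ` tensor_vectors"
    then obtain t where t: "Z = tensor_class t" "t \<in> tensor_vectors" by auto
    obtain z where "z \<in> tensor_class t" using tensor_class_nonempty[OF t(2)] .
    then show "Z \<in> (\<lambda>z. tensor_class (tensor_coords z)) ` {z. Poly_Mapping.keys z \<subseteq> carrier V \<times> carrier W}"
      using t by (auto simp: tensor_class_def)
  qed (use tensor_coords_in_vectors in auto)
  finally show ?thesis .
qed

lemma inj_tensor_class: "inj_on tensor_class tensor_vectors"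
  by (rule inj_onI) (metis (mono_tags, lifting) mem_Collect_eq tensor_class_def tensor_class_nonempty)

lemma add_tensor_class:
  assumes "t \<in> tensor_vectors" "t' \<in> tensor_vectors"
  shows "tensor_class t \<oplus>\<^bsub>tensor_module q n V W\<^esub> tensor_class t' = tensor_class (\<lambda>s. t s + t' s)"
proof -
  have eq: "tensor_class t \<oplus>\<^bsub>tensor_module q n V W\<^esub> tensor_class t' =
      {z + z' | z z'. z \<in> tensor_class t \<and> z' \<in> tensor_class t'}"
    by (auto simp: tensor_module_def set_add_def' free_space_def)
  show ?thesis
    unfolding eq
  proof (intro Set.set_eqI iffI)
    fix y assume "y \<in> {z + z' | z z'. z \<in> tensor_class t \<and> z' \<in> tensor_class t'}"
    then obtain z z' where "z \<in> tensor_class t" "z' \<in> tensor_class t'" "y = z + z'"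
      by auto
    then show "y \<in> tensor_class (\<lambda>s. t s + t' s)"
      using keys_add[of z z'] by (auto simp: tensor_class_def tensor_coords_add)
  next
    fix y assume y: "y \<in> tensor_class (\<lambda>s. t s + t' s)"
    obtain z where z: "z \<in> tensor_class t"
      using tensor_class_nonempty[OF assms(1)] .
    have "y - z \<in> tensor_class t'"
      using y z keys_diff[of y z] by (auto simp: tensor_class_def tensor_coords_diff)
    moreover have "y = z + (y - z)" by simp
    ultimately show "y \<in> {z + z' | z z'. z \<in> tensor_class t \<and> z' \<in> tensor_class t'}"
      using z by blast
  qed
qed

lemma zero_tensor_module: "\<zero>\<^bsub>tensor_module q n V W\<^esub> = tensor_class (\<lambda>s. 0)"
  by (simp add: tensor_module_def tensor_class_def tensor_kernel_eq)

lemma act2_tensor_coords: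
  assumes z: "Poly_Mapping.keys z \<subseteq> carrier V \<times> carrier W"
  shows "Poly_Mapping.keys (act2 q n V W p z) \<subseteq> carrier V \<times> carrier W"
    and "tensor_coords (act2 q n V W p z) = act_ext (word_pair_op q i u j v) p (tensor_coords z)"
proof -
  let ?f = "foldr (simple_gen_op q i u)" and ?g = "foldr (simple_gen_op q j v)"
  have word_V: "uq_class q n (Poly_Mapping.single w 1) \<odot>\<^bsub>V\<^esub> x = ?f w x" if "x \<in> carrier V" for w x
    using that by (simp add: in_V_iff simple_smult[OF u_le cong_u] simple_op_eq act_ext_single)
  have word_W: "uq_class q n (Poly_Mapping.single w 1) \<odot>\<^bsub>W\<^esub> x = ?g w x" if "x \<in> carrier W" for w x
    using that by (simp add: in_W_iff simple_smult[OF v_le cong_v] simple_op_eq act_ext_single)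
  have closed: "?f w x \<in> carrier V" "?g w y \<in> carrier W"
    if "x \<in> carrier V" "y \<in> carrier W" for w x y
    using that simple_word_closed[of u x q i w] simple_word_closed[of v y q j w]
    by (simp_all add: in_V_iff in_W_iff)
  have act2: "act2 q n V W p z = lin_ext (\<lambda>(w, w'). lin_ext (\<lambda>(x, y). pr (?f w x) (?g w' y)) z) p"
  proof -
    have "lin_ext (\<lambda>(x, y). pr (uq_class q n (Poly_Mapping.single w 1) \<odot>\<^bsub>V\<^esub> x)
            (uq_class q n (Poly_Mapping.single w' 1) \<odot>\<^bsub>W\<^esub> y)) z =
        lin_ext (\<lambda>(x, y). pr (?f w x) (?g w' y)) z" for w w'
      unfolding lin_ext_def using z word_V word_W by (intro sum.cong refl) auto
    then show ?thesis
      by (simp add: act2_def)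
  qed
  show "Poly_Mapping.keys (act2 q n V W p z) \<subseteq> carrier V \<times> carrier W"
    unfolding act2 using z closed
    by (fastforce dest!: subsetD[OF keys_lin_ext] split: prod.splits)
  have "tensor_coords (lin_ext (\<lambda>(x, y). pr (?f w x) (?g w' y)) z) (a, b) =
      word_pair_op q i u j v (w, w') (tensor_coords z) (a, b)" for w w' a b
  proof -
    have "word_pair_op q i u j v (w, w') (tensor_coords z) (a, b) =
        ?f w (\<lambda>a'. ?g w' (\<lambda>b'. lin_sum (\<lambda>p. fst p a' * snd p b') z) b) a"
      by (simp add: word_pair_op_def tens_op_def tensor_coords_def case_prod_unfold)
    also have "\<dots> = lin_sum (\<lambda>p. ?f w (fst p) a * ?g w' (snd p) b) z"
      by (simp add: linear_op_lin_sum[OF linear_simple_word] linear_op_scale[OF linear_simple_word]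
          linear_op_scale_right[OF linear_simple_word])
    finally show ?thesis
      by (simp add: tensor_coords_def lin_sum_lin_ext case_prod_beta)
  qed
  then show "tensor_coords (act2 q n V W p z) = act_ext (word_pair_op q i u j v) p (tensor_coords z)"
    unfolding act2
    by (auto simp: tensor_coords_def lin_sum_lin_ext[of _ _ p] act_ext_def fun_eq_iff
        intro!: lin_sum_cong)
qed

text \<open>The scalar product is a union over all representatives. It collapses to one coset if the
  representatives act alike on \<open>t\<close>, which follows once the tensor product is decomposed
  into modules over the quotient.\<close>

lemma smult_tensor_class:
  assumes t: "t \<in> tensor_vectors"
    and act: "\<And>b. b \<in> uq_class q n a \<Longrightarrow> act_ext (foldr gen_op) b t = t'"
  shows "uq_class q n a \<odot>\<^bsub>tensor_module q n V W\<^esub> tensor_class t = tensor_class t'"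
proof -
  have coset: "tensor_kernel q n V W +>\<^bsub>free_space V W\<^esub> act2 q n V W (comult n b) z = tensor_class t'"
    if "b \<in> uq_class q n a" "z \<in> tensor_class t" for b z
  proof -
    have z: "Poly_Mapping.keys z \<subseteq> carrier V \<times> carrier W" "tensor_coords z = t"
      using that(2) by (auto simp: tensor_class_def)
    show ?thesis
      by (simp add: tensor_coset act2_tensor_coords[OF z(1)] z(2) act_ext_comult act that(1))
  qed
  obtain z where z: "z \<in> tensor_class t"
    using tensor_class_nonempty[OF t] .
  have "uq_class q n a \<odot>\<^bsub>tensor_module q n V W\<^esub> tensor_class t =
      (\<Union>b\<in>uq_class q n a. \<Union>z\<in>tensor_class t.
        tensor_kernel q n V W +>\<^bsub>free_space V W\<^esub> act2 q n V W (comult n b) z)"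
    by (simp add: tensor_module_def)
  also have "\<dots> = (\<Union>b\<in>uq_class q n a. \<Union>z\<in>tensor_class t. tensor_class t')"
    using coset by simp
  also have "\<dots> = tensor_class t'"
    using z self_in_uq_class[of a q n] by blast
  finally show ?thesis .
qed

lemma gen_op_K:
  assumes "t \<in> tensor_vectors"
  shows "gen_op K t (a, b) = q powi (2 * (i + j + int a + int b)) * t (a, b)"
proof -
  have "q powi (2 * (i + j + int a + int b)) = q powi (2 * (i + int a)) * q powi (2 * (j + int b))"
    by (simp flip: power_int_add add: algebra_simps)
  then show ?thesis
    using assms
    by (auto simp: tensor_gen_op_def act_ext_single tens_def word_pair_op_def tens_op_def
        simple_gen_op_K tensor_vectors_def not_le simp del: mult.assoc)
qed

lemma gen_op_E:
  assumes "t \<in> tensor_vectors"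
  shows "gen_op E t (a, b) = (if a \<le> u \<and> b \<le> v then
    (if 0 < b then t (a, b - 1) else 0) +
    q powi (2 * (j + int b)) * (if 0 < a then t (a - 1, b) else 0) else 0)"
  using assms
  by (auto simp: tensor_gen_op_def act_ext_add act_ext_single tens_def word_pair_op_def tens_op_def
      simple_gen_op_K simple_gen_op_E tensor_vectors_def not_le)

lemma gen_op_F:
  assumes "t \<in> tensor_vectors"
  shows "gen_op F t (a, b) = (if a \<le> u \<and> b \<le> v then
    q powi (- (2 * (i + int a))) * (if b < v then lam q j b * t (a, b + 1) else 0) +
    (if a < u then lam q i a * t (a + 1, b) else 0) else 0)"
proof -
  have "simple_gen_op q j v F (\<lambda>b'. t (a', b')) b = 0" if "a' > u" for a'
    using assms that by (simp add: simple_gen_op_F tensor_vectors_def)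
  then have "foldr (simple_gen_op q i u) (K_inv_word n)
      (\<lambda>a'. simple_gen_op q j v F (\<lambda>b'. t (a', b')) b) a =
      q powi (- (2 * (i + int a))) * simple_gen_op q j v F (\<lambda>b'. t (a, b')) b"
    by (intro simple_word_K_inv) simp
  then show ?thesis
    using assms
    by (auto simp: tensor_gen_op_def act_ext_add act_ext_single tens_def word_pair_op_def tens_op_def
        simple_gen_op_F tensor_vectors_def not_le)
qed

lemma gen_op_closed: "t \<in> tensor_vectors \<Longrightarrow> gen_op g t \<in> tensor_vectors"
  by (cases g) (auto simp: gen_op_E gen_op_F gen_op_K tensor_vectors_def[unfolded mem_Collect_eq])

end

section \<open>Lowest weight vectors of the tensor product\<close>

text \<open>The coefficients that make the two terms of \<open>F\<close> cancel: \<open>F\<close>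
  sends \<open>e\<^sup>a \<otimes> f\<^sup>b\<^sup>+\<^sup>1\<close> and
  \<open>e\<^sup>a\<^sup>+\<^sup>1 \<otimes> f\<^sup>b\<close> to multiples of \<open>e\<^sup>a
  \<otimes> f\<^sup>b\<close>, up to other basis vectors.\<close>

primrec lowest_coeff :: "complex \<Rightarrow> int \<Rightarrow> int \<Rightarrow> nat \<Rightarrow> nat \<Rightarrow> complex" where
  "lowest_coeff q i j l 0 = 1"
| "lowest_coeff q i j l (Suc a) =
    - (q powi (- (2 * (i + int a))) * lam q j (l - Suc a) * lowest_coeff q i j l a / lam q i a)"

definition lowest :: "complex \<Rightarrow> int \<Rightarrow> int \<Rightarrow> nat \<Rightarrow> nat \<times> nat \<Rightarrow> complex" where
  "lowest q i j l = (\<lambda>(a, b). if a + b = l then lowest_coeff q i j l a else 0)"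

context simple_pair
begin

lemma tensor_vectors_simps:
  "t \<in> tensor_vectors \<Longrightarrow> u < a \<Longrightarrow> t (a, b) = 0"
  "t \<in> tensor_vectors \<Longrightarrow> v < b \<Longrightarrow> t (a, b) = 0"
  by (auto simp: tensor_vectors_def)

text \<open>The relation between \<open>E\<close> and \<open>F\<close> on the tensor product, from
  the relations on the factors and \<open>[x + y] = q\<^sup>-\<^sup>x [y] + q\<^sup>y
  [x]\<close>.\<close>

lemma gen_op_commutator:
  assumes t: "t \<in> tensor_vectors"
  shows "gen_op E (gen_op F t) (a, b) - gen_op F (gen_op E t) (a, b) =
    q_int q (2 * (i + j + int a + int b)) * t (a, b)"
proof (cases "a \<le> u \<and> b \<le> v")
  case True
  define A where "A = (\<lambda>a. q powi (- (2 * (i + int a))))"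
  define B where "B = (\<lambda>b. q powi (2 * (j + int b)))"
  define r where "r = q powi 2"
  have A: "A a' = r * A (Suc a')" for a'
  proof -
    have "- (2 * (i + int a')) = 2 + - (2 * (i + int (Suc a')))" by simp
    then show ?thesis
      unfolding A_def r_def by (simp only: power_int_add q_nonzero simp_thms)
  qed
  have B: "B (Suc b') = r * B b'" for b'
  proof -
    have "2 * (j + int (Suc b')) = 2 + 2 * (j + int b')" by simp
    then show ?thesis
      unfolding B_def r_def by (simp only: power_int_add q_nonzero simp_thms)
  qed
  \<comment> \<open>The coefficients of \<open>E F\<close> and \<open>F E\<close> with their values at the boundary. The mixed terms cancel
    because both carry the factor \<open>q\<^sup>2\<close> recorded in \<open>A\<close> and \<open>B\<close>.\<close>
  define la where "la = (if a = 0 then 0 else lam q i (a - 1))"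
  define la' where "la' = (if a < u then lam q i a else 0)"
  define lb where "lb = (if b = 0 then 0 else lam q j (b - 1))"
  define lb' where "lb' = (if b < v then lam q j b else 0)"
  have E: "gen_op E t (a, b) = (if a \<le> u \<and> b \<le> v then
      (if 0 < b then t (a, b - 1) else 0) + B b * (if 0 < a then t (a - 1, b) else 0) else 0)"
    if "t \<in> tensor_vectors" for t a b
    unfolding B_def by (rule gen_op_E[OF that])
  have F: "gen_op F t (a, b) = (if a \<le> u \<and> b \<le> v then
      A a * (if b < v then lam q j b * t (a, b + 1) else 0) +
      (if a < u then lam q i a * t (a + 1, b) else 0) else 0)"
    if "t \<in> tensor_vectors" for t a b
    unfolding A_def by (rule gen_op_F[OF that])
  have EF: "gen_op E (gen_op F t) (a, b) =
      A a * lb * t (a, b) + (if b = 0 then 0 else la' * t (a + 1, b - 1)) +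
      B b * (r * A a * lb' * (if a = 0 then 0 else t (a - 1, b + 1)) + la * t (a, b))"
    using True unfolding E[OF gen_op_closed[OF t]] F[OF t] la_def la'_def lb_def lb'_def
    by (cases a; cases b) (simp_all flip: A)
  have FE: "gen_op F (gen_op E t) (a, b) =
      A a * lb' * (t (a, b) + r * B b * (if a = 0 then 0 else t (a - 1, b + 1))) +
      la' * ((if b = 0 then 0 else t (a + 1, b - 1)) + B b * t (a, b))"
    using True unfolding F[OF gen_op_closed[OF t]] E[OF t] la'_def lb'_def
    by (cases a; cases b) (simp_all add: B Suc_le_eq)
  have "gen_op E (gen_op F t) (a, b) - gen_op F (gen_op E t) (a, b) =
      (A a * (lb - lb') + B b * (la - la')) * t (a, b)"
    unfolding EF FE by (simp add: algebra_simps)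
  also have "la - la' = q_int q (2 * (i + int a))"
    using lam_step[OF cong_u, of a] True by (simp add: la_def la'_def)
  also have "lb - lb' = q_int q (2 * (j + int b))"
    using lam_step[OF cong_v, of b] True by (simp add: lb_def lb'_def)
  also have "A a * q_int q (2 * (j + int b)) + B b * q_int q (2 * (i + int a)) =
      q_int q (2 * (i + int a) + 2 * (j + int b))"
    by (simp only: q_int_add A_def B_def)
  also have "2 * (i + int a) + 2 * (j + int b) = 2 * (i + j + int a + int b)"
    by simp
  finally show ?thesis .
next
  case False
  then show ?thesis
    using t by (auto simp: tensor_vectors_simps gen_op_closed)
qed

definition homogeneous :: "nat \<Rightarrow> (nat \<times> nat \<Rightarrow> complex) \<Rightarrow> bool" where
  "homogeneous k t \<longleftrightarrow> t \<in> tensor_vectors \<and> (\<forall>a b. a + b \<noteq> k \<longrightarrow> t (a, b) = 0)"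

lemma homogeneous_closed: "homogeneous k t \<Longrightarrow> t \<in> tensor_vectors"
  by (simp add: homogeneous_def)

lemma homogeneous_gen_op_E: "homogeneous k t \<Longrightarrow> homogeneous (Suc k) (gen_op E t)"
  by (auto simp: homogeneous_def gen_op_closed gen_op_E)

lemma homogeneous_gen_op_F: "homogeneous (Suc k) t \<Longrightarrow> homogeneous k (gen_op F t)"
  by (auto simp: homogeneous_def gen_op_closed gen_op_F)

lemma homogeneous_gen_op_F_0: "homogeneous 0 t \<Longrightarrow> gen_op F t = (\<lambda>s. 0)"
  by (auto simp: homogeneous_def gen_op_F fun_eq_iff)

lemma homogeneous_scale: "homogeneous k t \<Longrightarrow> homogeneous k (\<lambda>s. c * t s)"
  by (auto simp: homogeneous_def tensor_vectors_def)

lemma homogeneous_diff: "homogeneous k t \<Longrightarrow> homogeneous k t' \<Longrightarrow> homogeneous k (\<lambda>s. t s - t' s)"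
  by (auto simp: homogeneous_def tensor_vectors_def)

lemma homogeneous_sum:
  "(\<And>l. l \<in> I \<Longrightarrow> homogeneous k (f l)) \<Longrightarrow> homogeneous k (\<lambda>s. \<Sum>l\<in>I. f l s)"
  by (auto simp: homogeneous_def tensor_vectors_def)

lemma lam_u_nonzero: "k < u \<Longrightarrow> lam q i k \<noteq> 0"
  by (rule lam_nonzero[OF cong_u u_le])

text \<open>The coefficient of \<open>F t\<close> at \<open>e\<^sup>a \<otimes> f\<^sup>b\<close>
  involves only two coefficients of \<open>t\<close>, and the one with the larger first index comes
  with a nonzero factor. So vanishing propagates along the antidiagonal from \<open>e\<^sup>0
  \<otimes> f\<^sup>k\<close>. In degrees \<open>k > v\<close> there is no such basis vector, and
  \<open>F\<close> is injective.\<close>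

lemma F_kernel:
  assumes t: "homogeneous k t" and F: "gen_op F t = (\<lambda>s. 0)" and 0: "t (0, k) = 0"
  shows "t = (\<lambda>s. 0)"
proof -
  note tv = homogeneous_closed[OF t]
  have diag: "t (a, b) = 0" if "a + b = k" for a b
    using that
  proof (induction a arbitrary: b)
    case 0
    then show ?case using \<open>t (0, k) = 0\<close> by simp
  next
    case (Suc a)
    show ?case
    proof (cases "Suc a \<le> u \<and> b \<le> v")
      case True
      have "t (a, Suc b) = 0" using Suc by simp
      moreover have "gen_op F t (a, b) = 0" by (simp add: F)
      ultimately have "lam q i a * t (Suc a, b) = 0"
        using True by (simp add: gen_op_F[OF tv] split: if_splits)
      then show ?thesis
        using lam_u_nonzero[of a] True by simp
    next
      case False
      then show ?thesis using tensor_vectors_simps[OF tv] by auto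
    qed
  qed
  have "t (a, b) = 0" for a b
    using diag t by (cases "a + b = k") (auto simp: homogeneous_def)
  then show ?thesis by auto
qed

end

locale small_pair = simple_pair +
  assumes sum_le: "u + v \<le> d - 1" and v_le_u: "v \<le> u"
begin

text \<open>The highest index and the lowest weight of the \<open>l\<close>-th summand.\<close>

abbreviation m :: "nat \<Rightarrow> nat" where "m l \<equiv> u + v - 2 * l"

abbreviation s :: "nat \<Rightarrow> int" where "s l \<equiv> i + j + int l"

lemma cong_m:
  assumes "l \<le> v"
  shows "[int (m l) = - 2 * s l] (mod int d)"
proof -
  have "int (m l) = int u + int v - 2 * int l"
    using assms v_le_u by (simp add: of_nat_diff)
  moreover have "[int u + int v - 2 * int l = - 2 * i + - 2 * j - 2 * int l] (mod int d)"
    by (intro cong_diff cong_add cong_refl cong_u cong_v)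
  moreover have "- 2 * i + - 2 * j - 2 * int l = - 2 * s l"
    by simp
  ultimately show ?thesis by simp
qed

lemma m_le: "m l \<le> d - 1"
  using sum_le by simp

lemma lam_m_nonzero: "l \<le> v \<Longrightarrow> k < m l \<Longrightarrow> lam q (s l) k \<noteq> 0"
  by (rule lam_nonzero[OF cong_m m_le])

lemma homogeneous_lowest: "l \<le> v \<Longrightarrow> homogeneous l (lowest q i j l)"
  using v_le_u by (auto simp: homogeneous_def tensor_vectors_def lowest_def)

lemma gen_op_F_lowest:
  assumes l: "l \<le> v"
  shows "gen_op F (lowest q i j l) = (\<lambda>s. 0)"
proof -
  have "gen_op F (lowest q i j l) (a, b) = 0" for a b
  proof (cases "a + b + 1 = l")
    case True
    then have b: "b = l - Suc a" "b < v" "a < u" using l v_le_u by auto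
    then show ?thesis
      using True lam_u_nonzero[OF b(3)] v_le_u
      unfolding gen_op_F[OF homogeneous_closed[OF homogeneous_lowest[OF l]]]
      by (auto simp: lowest_def)
  next
    case False
    then show ?thesis
      unfolding gen_op_F[OF homogeneous_closed[OF homogeneous_lowest[OF l]]]
      by (auto simp: lowest_def)
  qed
  then show ?thesis by auto
qed

definition string :: "nat \<Rightarrow> nat \<Rightarrow> nat \<times> nat \<Rightarrow> complex" where
  "string l k = (gen_op E ^^ k) (lowest q i j l)"

lemma string_0: "string l 0 = lowest q i j l"
  and string_Suc: "string l (Suc k) = gen_op E (string l k)"
  by (simp_all add: string_def)

lemma homogeneous_string: "l \<le> v \<Longrightarrow> homogeneous (l + k) (string l k)"
  by (induction k) (simp_all add: string_0 string_Suc homogeneous_lowest homogeneous_gen_op_E)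

lemma gen_op_K_string:
  assumes "l \<le> v"
  shows "gen_op K (string l k) = (\<lambda>x. q powi (2 * (s l + int k)) * string l k x)"
proof -
  note h = homogeneous_string[OF assms, of k]
  have "gen_op K (string l k) (a, b) = q powi (2 * (s l + int k)) * string l k (a, b)" for a b
  proof (cases "a + b = l + k")
    case True
    then have "i + j + int a + int b = s l + int k" by linarith
    then show ?thesis
      by (simp only: gen_op_K[OF homogeneous_closed[OF h]])
  next
    case False
    then show ?thesis
      using h by (simp add: gen_op_K[OF homogeneous_closed[OF h]] homogeneous_def)
  qed
  then show ?thesis by auto
qed

text \<open>Induction on \<open>k\<close>: moving \<open>F\<close> past one \<open>E\<close>
  contributes the quantum integer of the weight, and these add up to the structure constant.\<close>

lemma gen_op_F_string:
  assumes l: "l \<le> v"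
  shows "gen_op F (string l (Suc k)) = (\<lambda>x. lam q (s l) k * string l k x)"
proof -
  have step: "gen_op F (string l (Suc k)) (a, b) =
      gen_op E (gen_op F (string l k)) (a, b) - q_int q (2 * (s l + int k)) * string l k (a, b)"
    for k a b
  proof -
    note h = homogeneous_string[OF l, of k]
    have "q_int q (2 * (i + j + int a + int b)) * string l k (a, b) =
        q_int q (2 * (s l + int k)) * string l k (a, b)"
    proof (cases "a + b = l + k")
      case True
      then have "i + j + int a + int b = s l + int k" by linarith
      then show ?thesis by (simp only:)
    next
      case False
      then show ?thesis using h by (simp add: homogeneous_def)
    qed
    with gen_op_commutator[OF homogeneous_closed[OF h], of a b] show ?thesis
      unfolding string_Suc by (simp only: diff_eq_eq eq_diff_eq add.commute)
  qed
  have "gen_op F (string l (Suc k)) (a, b) = lam q (s l) k * string l k (a, b)" for a b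
  proof (induction k arbitrary: a b)
    case 0
    show ?case
      by (simp add: step string_0 gen_op_F_lowest[OF l] linear_op_zero[OF linear_tensor_gen_op] lam_0)
  next
    case (Suc k)
    have "gen_op F (string l (Suc k)) = (\<lambda>x. lam q (s l) k * string l k x)"
      using Suc.IH by (intro ext) (simp only: split_paired_all)
    then have "gen_op E (gen_op F (string l (Suc k))) = (\<lambda>x. lam q (s l) k * string l (Suc k) x)"
      by (simp only: linear_op_scale[OF linear_tensor_gen_op] string_Suc)
    then show ?case
      by (simp only: step[of "Suc k"] lam_Suc left_diff_distrib)
  qed
  then show ?thesis by auto
qed

text \<open>The vector is killed by \<open>F\<close>, because the structure constant at the highest
  index is zero, and its degree \<open>u + v - l + 1\<close> is too large for a nonzero vector
  killed by \<open>F\<close>.\<close>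

lemma string_vanishes:
  assumes l: "l \<le> v"
  shows "string l (Suc (m l)) = (\<lambda>x. 0)"
proof (rule F_kernel)
  show h: "homogeneous (l + Suc (m l)) (string l (Suc (m l)))"
    by (rule homogeneous_string[OF l])
  show "gen_op F (string l (Suc (m l))) = (\<lambda>x. 0)"
    by (simp add: gen_op_F_string[OF l] lam_top_eq_0[OF cong_m[OF l]])
  show "string l (Suc (m l)) (0, l + Suc (m l)) = 0"
    by (rule tensor_vectors_simps(2)[OF homogeneous_closed[OF h]]) (use l v_le_u in simp)
qed

lemma gen_op_string:
  assumes l: "l \<le> v" and k: "k \<le> m l"
  shows "gen_op g (string l k) x = (\<Sum>k'=0..m l. simple_gen q (s l) (m l) g k k' * string l k' x)"
proof (cases g)
  case K
  have "(\<Sum>k'=0..m l. simple_gen q (s l) (m l) K k k' * string l k' x) =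
      (\<Sum>k'=0..m l. if k = k' then q powi (2 * (s l + int k)) * string l k x else 0)"
    by (rule sum.cong) (auto simp: bvec_def)
  then show ?thesis
    using k by (simp add: K gen_op_K_string[OF l] sum.delta)
next
  case E
  have "(\<Sum>k'=0..m l. simple_gen q (s l) (m l) E k k' * string l k' x) =
      (\<Sum>k'=0..m l. if Suc k = k' then string l (Suc k) x else 0)"
    by (rule sum.cong) (auto simp: bvec_def)
  moreover have "string l (Suc k) x = 0" if "\<not> Suc k \<le> m l"
    using that k string_vanishes[OF l] by (simp add: le_antisym not_less_eq_eq)
  ultimately show ?thesis
    by (auto simp: E string_Suc[symmetric] sum.delta)
next
  case F
  show ?thesis
  proof (cases k)
    case 0
    then show ?thesis
      by (simp add: F string_0 gen_op_F_lowest[OF l])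
  next
    case (Suc k0)
    have "(\<Sum>k'=0..m l. simple_gen q (s l) (m l) F k k' * string l k' x) =
        (\<Sum>k'=0..m l. if k0 = k' then lam q (s l) k0 * string l k0 x else 0)"
      by (rule sum.cong) (auto simp: bvec_def Suc)
    then show ?thesis
      using k by (simp add: F Suc gen_op_F_string[OF l] sum.delta)
  qed
qed

section \<open>The decomposition\<close>

text \<open>The linear map that sends the \<open>k\<close>-th basis vector of the
  \<open>l\<close>-th summand to \<open>string l k\<close>.\<close>

definition assemble :: "(nat \<Rightarrow> nat \<Rightarrow> complex) \<Rightarrow> nat \<times> nat \<Rightarrow> complex" where
  "assemble x = (\<lambda>p. \<Sum>l=0..v. \<Sum>k=0..m l. x l k * string l k p)"

lemma assemble_cong:
  "(\<And>l. l \<le> v \<Longrightarrow> x l = y l) \<Longrightarrow> assemble x = assemble y"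
  by (simp add: assemble_def)

lemma assemble_add: "assemble (\<lambda>l k. x l k + y l k) = (\<lambda>p. assemble x p + assemble y p)"
  by (simp add: assemble_def algebra_simps sum.distrib)

lemma assemble_scale: "assemble (\<lambda>l k. c * x l k) = (\<lambda>p. c * assemble x p)"
  by (simp add: assemble_def sum_distrib_left mult.assoc)

lemma assemble_zero: "assemble (\<lambda>l k. 0) = (\<lambda>p. 0)"
  by (simp add: assemble_def)

lemma assemble_closed: "assemble x \<in> tensor_vectors"
proof -
  have "string l k (a, b) = 0" if "l \<le> v" "u < a \<or> v < b" for l k a b
    using tensor_vectors_simps[OF homogeneous_closed[OF homogeneous_string[OF that(1), of k]]] that(2)
    by auto
  then show ?thesis
    by (auto simp: tensor_vectors_def assemble_def intro!: sum.neutral)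
qed

lemma assemble_string:
  assumes "l \<le> v" "k \<le> m l"
  shows "assemble (\<lambda>l' k'. if l' = l \<and> k' = k then 1 else 0) = string l k"
proof
  fix p
  have "assemble (\<lambda>l' k'. if l' = l \<and> k' = k then 1 else 0) p =
      (\<Sum>l'=0..v. if l' = l then (\<Sum>k'=0..m l. if k' = k then string l k p else 0) else 0)"
    unfolding assemble_def
  proof (intro sum.cong refl)
    fix l'
    show "(\<Sum>k'=0..m l'. (if l' = l \<and> k' = k then 1 else 0) * string l' k' p) =
        (if l' = l then (\<Sum>k'=0..m l. if k' = k then string l k p else 0) else 0)"
      by (simp add: mult_delta_left)
  qed
  also have "\<dots> = string l k p"
    using assms by (simp add: sum.delta)
  finally show "assemble (\<lambda>l' k'. if l' = l \<and> k' = k then 1 else 0) p = string l k p" .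
qed

lemma assemble_gen_op:
  "assemble (\<lambda>l. simple_gen_op q (s l) (m l) g (x l)) = gen_op g (assemble x)"
proof
  fix p
  have "gen_op g (assemble x) p = (\<Sum>l=0..v. \<Sum>k=0..m l. x l k * gen_op g (string l k) p)"
    unfolding assemble_def
    by (simp add: linear_op_sum[OF linear_tensor_gen_op] linear_op_scale[OF linear_tensor_gen_op])
  also have "\<dots> = (\<Sum>l=0..v. \<Sum>k=0..m l. simple_gen_op q (s l) (m l) g (x l) k * string l k p)"
  proof (rule sum.cong[OF refl])
    fix l assume "l \<in> {0..v}"
    then have "(\<Sum>k=0..m l. x l k * gen_op g (string l k) p) =
        (\<Sum>k=0..m l. \<Sum>k'=0..m l. x l k * simple_gen q (s l) (m l) g k k' * string l k' p)"
      by (intro sum.cong refl) (simp add: gen_op_string sum_distrib_left mult.assoc)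
    also have "\<dots> = (\<Sum>k'=0..m l. simple_gen_op q (s l) (m l) g (x l) k' * string l k' p)"
      by (subst sum.swap) (simp add: simple_gen_op_def sum_distrib_right)
    finally show "(\<Sum>k=0..m l. x l k * gen_op g (string l k) p) =
        (\<Sum>k=0..m l. simple_gen_op q (s l) (m l) g (x l) k * string l k p)" .
  qed
  finally show "assemble (\<lambda>l. simple_gen_op q (s l) (m l) g (x l)) p = gen_op g (assemble x) p"
    by (simp add: assemble_def)
qed

lemma assemble_word:
  "assemble (\<lambda>l. foldr (simple_gen_op q (s l) (m l)) w (x l)) = foldr gen_op w (assemble x)"
  by (induction w) (simp_all add: assemble_gen_op)

lemma assemble_act:
  "assemble (\<lambda>l. simple_op q (s l) (m l) a (x l)) = act_ext (foldr gen_op) a (assemble x)"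
proof
  fix p
  have "act_ext (foldr gen_op) a (assemble x) p =
      (\<Sum>w\<in>Poly_Mapping.keys a. \<Sum>l=0..v. \<Sum>k=0..m l.
        Poly_Mapping.lookup a w * foldr (simple_gen_op q (s l) (m l)) w (x l) k * string l k p)"
    by (simp add: act_ext_def lin_sum_def assemble_word[symmetric])
       (simp add: assemble_def sum_distrib_left mult.assoc)
  also have "\<dots> = (\<Sum>l=0..v. \<Sum>k=0..m l. simple_op q (s l) (m l) a (x l) k * string l k p)"
    by (subst sum.swap, rule sum.cong[OF refl], subst sum.swap, rule sum.cong[OF refl])
       (simp add: simple_op_def sum_distrib_right)
  finally show "assemble (\<lambda>l. simple_op q (s l) (m l) a (x l)) p =
      act_ext (foldr gen_op) a (assemble x) p"
    by (simp add: assemble_def)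
qed

lemma lowest_corner: "lowest q i j l (0, l') = (if l = l' then 1 else 0)"
  by (simp add: lowest_def)

text \<open>If \<open>x\<close> is supported in indices \<open>k \<le> N\<close> and assembles to
  zero, then so does its image under \<open>F\<close>, which is supported in \<open>k < N\<close>
  and determines all entries of \<open>x\<close> with \<open>k > 0\<close>. What remains is a
  relation between the lowest weight vectors, which the coefficients at \<open>e\<^sup>0 \<otimes>
  f\<^sup>l\<close> tell apart.\<close>

lemma assemble_injective:
  assumes "assemble x = (\<lambda>p. 0)" and "l \<le> v" "k \<le> m l"
  shows "x l k = 0"
proof -
  have zero: "x l 0 = 0"
    if x: "assemble x = (\<lambda>p. 0)" "\<And>l k. l \<le> v \<Longrightarrow> 0 < k \<Longrightarrow> k \<le> m l \<Longrightarrow> x l k = 0" and l: "l \<le> v"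
    for x l
  proof -
    have "(\<Sum>k=0..m l'. x l' k * string l' k (0, l)) = (if l' = l then x l 0 else 0)"
      if l': "l' \<le> v" for l'
    proof -
      have "(\<Sum>k=0..m l'. x l' k * string l' k (0, l)) = (\<Sum>k\<in>{0}. x l' k * string l' k (0, l))"
        by (rule sum.mono_neutral_right) (use x(2)[OF l'] in auto)
      then show ?thesis
        by (simp add: string_0 lowest_corner)
    qed
    then have "assemble x (0, l) = (\<Sum>l'=0..v. if l' = l then x l 0 else 0)"
      unfolding assemble_def by (intro sum.cong) auto
    then show ?thesis
      using x(1) l by (simp add: sum.delta)
  qed
  have "\<forall>l\<le>v. \<forall>k\<le>m l. x l k = 0"
    if "assemble x = (\<lambda>p. 0)" "\<And>l k. l \<le> v \<Longrightarrow> N < k \<Longrightarrow> k \<le> m l \<Longrightarrow> x l k = 0" for N x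
    using that
  proof (induction N arbitrary: x)
    case 0
    then show ?case
      using zero[of x] by (metis gr_zeroI)
  next
    case (Suc N)
    let ?y = "\<lambda>l. simple_gen_op q (s l) (m l) F (x l)"
    have y: "?y l k = (if k < m l then lam q (s l) k * x l (k + 1) else 0)" for l k
      by (rule simple_gen_op_F)
    have "assemble ?y = (\<lambda>p. 0)"
      using Suc.prems(1) by (simp add: assemble_gen_op linear_op_zero[OF linear_tensor_gen_op])
    moreover have "?y l k = 0" if "l \<le> v" "N < k" "k \<le> m l" for l k
      using Suc.prems(2)[of l "Suc k"] that by (simp add: y)
    ultimately have "\<forall>l\<le>v. \<forall>k\<le>m l. ?y l k = 0"
      by (rule Suc.IH)
    then have pos: "x l k = 0" if "l \<le> v" "0 < k" "k \<le> m l" for l k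
      using that lam_m_nonzero[of l "k - 1"] y[of l "k - 1"] by (cases k) auto
    then show ?case
      using zero[OF Suc.prems(1) pos] by (metis gr_zeroI)
  qed
  \<comment> \<open>No index exceeds \<open>u + v\<close>, so the support condition is empty for this \<open>N\<close>.\<close>
  from this[of x "u + v"] show ?thesis
    using assms by auto
qed

text \<open>Decompose \<open>F t\<close> by induction and lift the result along \<open>F\<close>;
  this is possible since no string ends below degree \<open>v\<close>. The difference from
  \<open>t\<close> is killed by \<open>F\<close>, hence a multiple of the lowest weight
  vector.\<close>

lemma homogeneous_decomposition:
  assumes "k \<le> v" "homogeneous k t"
  shows "\<exists>c. t = (\<lambda>p. \<Sum>l=0..k. c l * string l (k - l) p)"
  using assms
proof (induction k arbitrary: t)
  case 0
  define r where "r = t (0, 0)"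
  let ?t' = "\<lambda>p. t p - r * lowest q i j 0 p"
  have h: "homogeneous 0 ?t'"
    using 0 by (intro homogeneous_diff homogeneous_scale homogeneous_lowest)
  have "?t' = (\<lambda>p. 0)"
    by (rule F_kernel[OF h homogeneous_gen_op_F_0[OF h]]) (simp add: lowest_corner r_def)
  then have "t = (\<lambda>p. r * string 0 0 p)"
    by (simp add: string_0 fun_eq_iff)
  then show ?case
    by (intro exI[of _ "\<lambda>l. r"]) simp
next
  case (Suc k)
  obtain c where c: "gen_op F t = (\<lambda>p. \<Sum>l=0..k. c l * string l (k - l) p)"
    using Suc.IH[of "gen_op F t"] Suc.prems homogeneous_gen_op_F by auto
  \<comment> \<open>\<open>t1\<close> is the lift: \<open>F\<close> multiplies the vectors of the strings by these structure constants.\<close>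
  define c' where "c' = (\<lambda>l. c l / lam q (s l) (k - l))"
  define t1 where "t1 = (\<lambda>p. \<Sum>l=0..k. c' l * string l (Suc k - l) p)"
  have lv: "l \<le> v" if "l \<in> {0..k}" for l
    using that Suc.prems(1) by simp
  have "homogeneous (Suc k) (string l (Suc k - l))" if "l \<in> {0..k}" for l
    using homogeneous_string[OF lv[OF that], of "Suc k - l"] that by simp
  then have h1: "homogeneous (Suc k) t1"
    unfolding t1_def by (intro homogeneous_sum homogeneous_scale)
  have F1: "gen_op F t1 = gen_op F t"
  proof -
    have "gen_op F t1 = (\<lambda>p. \<Sum>l=0..k. c' l * gen_op F (string l (Suc k - l)) p)"
      unfolding t1_def
      by (simp add: linear_op_sum[OF linear_tensor_gen_op] linear_op_scale[OF linear_tensor_gen_op])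
    also have "\<dots> = (\<lambda>p. \<Sum>l=0..k. c l * string l (k - l) p)"
    proof (intro ext sum.cong refl)
      fix p l assume l: "l \<in> {0..k}"
      then have "lam q (s l) (k - l) \<noteq> 0"
        using Suc.prems(1) v_le_u by (intro lam_m_nonzero) auto
      moreover have "Suc k - l = Suc (k - l)"
        using l by (simp add: Suc_diff_le)
      ultimately show "c' l * gen_op F (string l (Suc k - l)) p = c l * string l (k - l) p"
        by (simp add: gen_op_F_string[OF lv[OF l]] c'_def)
    qed
    finally show ?thesis by (simp only: c)
  qed
  define r where "r = t (0, Suc k) - t1 (0, Suc k)"
  let ?t' = "\<lambda>p. (t p - t1 p) - r * lowest q i j (Suc k) p"
  have h: "homogeneous (Suc k) ?t'"
    using Suc.prems h1 by (intro homogeneous_diff homogeneous_scale homogeneous_lowest)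
  have "gen_op F ?t' = (\<lambda>p. 0)"
    by (simp add: linear_op_diff[OF linear_tensor_gen_op] linear_op_scale[OF linear_tensor_gen_op]
        F1 gen_op_F_lowest[OF Suc.prems(1)])
  then have "?t' = (\<lambda>p. 0)"
    by (rule F_kernel[OF h]) (simp add: lowest_corner r_def)
  then have "t p = t1 p + r * lowest q i j (Suc k) p" for p
    using fun_cong[of ?t' "\<lambda>p. 0" p] by (simp add: algebra_simps)
  then have "t = (\<lambda>p. \<Sum>l=0..Suc k. (c'(Suc k := r)) l * string l (Suc k - l) p)"
    by (simp add: t1_def string_0 fun_eq_iff)
  then show ?case by blast
qed

text \<open>It suffices to reach the basis. The vectors \<open>e\<^sup>0 \<otimes> f\<^sup>b\<close>
  have degree at most \<open>v\<close>, and \<open>E (e\<^sup>a \<otimes> f\<^sup>b) =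
  q\<^sup>2\<^sup>(\<^sup>j\<^sup>+\<^sup>b\<^sup>) e\<^sup>a\<^sup>+\<^sup>1 \<otimes> f\<^sup>b +
  e\<^sup>a \<otimes> f\<^sup>b\<^sup>+\<^sup>1\<close> allows an induction on
  \<open>a\<close>.\<close>

lemma assemble_surjective:
  assumes t: "t \<in> tensor_vectors"
  shows "t \<in> range assemble"
proof -
  let ?R = "range assemble"
  have add: "(\<lambda>p. y p + z p) \<in> ?R" if "y \<in> ?R" "z \<in> ?R" for y z
    using that(1)
  proof
    fix y' assume y: "y = assemble y'"
    from that(2) show ?thesis
    proof
      fix z' assume z: "z = assemble z'"
      show ?thesis
        unfolding y z assemble_add[symmetric] by (rule rangeI)
    qed
  qed
  have scale: "(\<lambda>p. c * y p) \<in> ?R" if "y \<in> ?R" for y c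
    using that
  proof
    fix y' assume y: "y = assemble y'"
    show ?thesis
      unfolding y assemble_scale[symmetric] by (rule rangeI)
  qed
  have zero: "(\<lambda>p. 0) \<in> ?R"
    unfolding assemble_zero[symmetric] by (rule rangeI)
  have sum: "(\<lambda>p. \<Sum>i\<in>I. f i p) \<in> ?R" if "finite I" "\<And>i. i \<in> I \<Longrightarrow> f i \<in> ?R" for I and f :: "nat \<Rightarrow> _"
    using that
  proof (induction I)
    case empty
    then show ?case using zero by simp
  next
    case (insert i I)
    then show ?case using add[of "f i" "\<lambda>p. \<Sum>i\<in>I. f i p"] by simp
  qed
  have E: "gen_op E y \<in> ?R" if "y \<in> ?R" for y
    using that
  proof
    fix y' assume y: "y = assemble y'"
    show ?thesis
      unfolding y assemble_gen_op[symmetric] by (rule rangeI)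
  qed
  \<comment> \<open>The basis vector \<open>e\<^sup>a \<otimes> f\<^sup>b\<close>.\<close>
  let ?e = "\<lambda>a b p. if p = (a, b) then 1 else (0::complex)"
  have e_closed: "?e a b \<in> tensor_vectors" if "a \<le> u" "b \<le> v" for a b
    using that by (auto simp: tensor_vectors_def)
  have e: "?e a b \<in> ?R" if "a \<le> u" "b \<le> v" for a b
    using that
  proof (induction a arbitrary: b)
    case 0
    have "homogeneous b (?e 0 b)"
      using e_closed[OF 0] by (auto simp: homogeneous_def)
    then obtain c where c: "?e 0 b = (\<lambda>p. \<Sum>l=0..b. c l * string l (b - l) p)"
      using homogeneous_decomposition[OF 0(2)] by blast
    have "string l (b - l) \<in> ?R" if "l \<in> {0..b}" for l
    proof -
      have "l \<le> v" "b - l \<le> m l" using that 0 v_le_u by auto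
      then show ?thesis
        by (subst assemble_string[symmetric]) simp_all
    qed
    then have "(\<lambda>p. \<Sum>l=0..b. c l * string l (b - l) p) \<in> ?R"
      by (intro sum[of "{0..b}" "\<lambda>l p. c l * string l (b - l) p"] scale finite_atLeastAtMost)
    then show ?case
      unfolding c .
  next
    case (Suc a)
    let ?c = "q powi (2 * (j + int b))"
    have IH: "?e a b \<in> ?R" "b + 1 \<le> v \<Longrightarrow> ?e a (b + 1) \<in> ?R"
      using Suc by simp_all
    have nz: "?c \<noteq> 0" by simp
    have up: "gen_op E (?e a b) = (\<lambda>p. ?c * ?e (Suc a) b p + (if b + 1 \<le> v then ?e a (b + 1) p else 0))"
    proof
      fix p :: "nat \<times> nat"
      obtain a' b' where p: "p = (a', b')" by force
      have "a \<le> u" using Suc.prems by simp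
      then show "gen_op E (?e a b) p = ?c * ?e (Suc a) b p + (if b + 1 \<le> v then ?e a (b + 1) p else 0)"
        using Suc.prems unfolding p
        by (subst gen_op_E[OF e_closed], simp, simp, cases a'; cases "b' = b")
           (auto simp del: distrib_left_numeral)
    qed
    \<comment> \<open>\<open>r\<close> is \<open>e\<^sup>a \<otimes> f\<^sup>b\<^sup>+\<^sup>1\<close>, which is zero if \<open>b = v\<close>.\<close>
    define r where "r = (\<lambda>p. if b + 1 \<le> v then ?e a (b + 1) p else 0)"
    have "r \<in> ?R"
      using IH(2) zero by (cases "b + 1 \<le> v") (simp_all add: r_def)
    then have "(\<lambda>p. - 1 * r p) \<in> ?R"
      by (rule scale)
    then have "(\<lambda>p. gen_op E (?e a b) p + - 1 * r p) \<in> ?R"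
      by (rule add[OF E[OF IH(1)]])
    then have "(\<lambda>p. inverse ?c * (gen_op E (?e a b) p + - 1 * r p)) \<in> ?R"
      by (rule scale)
    moreover have "(\<lambda>p. inverse ?c * (gen_op E (?e a b) p + - 1 * r p)) = ?e (Suc a) b"
      unfolding up r_def using nz by (intro ext) simp
    ultimately show ?case by (simp only:)
  qed
  have "(\<lambda>p. \<Sum>b=0..v. t (a, b) * ?e a b p) \<in> ?R" if "a \<le> u" for a
  proof (rule sum[of "{0..v}" "\<lambda>b p. t (a, b) * ?e a b p"])
    fix b assume "b \<in> {0..v}"
    then have "?e a b \<in> ?R"
      using that by (intro e) simp_all
    then show "(\<lambda>p. t (a, b) * ?e a b p) \<in> ?R"
      by (rule scale)
  qed (rule finite_atLeastAtMost)
  then have "(\<lambda>p. \<Sum>a=0..u. \<Sum>b=0..v. t (a, b) * ?e a b p) \<in> ?R"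
    by (intro sum[of "{0..u}" "\<lambda>a p. \<Sum>b=0..v. t (a, b) * ?e a b p"]) simp_all
  moreover have "(\<lambda>p. \<Sum>a=0..u. \<Sum>b=0..v. t (a, b) * ?e a b p) = t"
  proof
    fix p :: "nat \<times> nat"
    obtain a' b' where p: "p = (a', b')" by force
    have "(\<Sum>a=0..u. \<Sum>b=0..v. t (a, b) * ?e a b p) =
        (\<Sum>a=0..u. if a' = a then \<Sum>b=0..v. if b' = b then t (a, b) else 0 else 0)"
      unfolding p by (intro sum.cong refl) (simp add: mult_delta_right)
    also have "\<dots> = t p"
      using t unfolding p by (auto simp: sum.delta' tensor_vectors_def not_le)
    finally show "(\<Sum>a=0..u. \<Sum>b=0..v. t (a, b) * ?e a b p) = t p" .
  qed
  ultimately show ?thesis by (simp only:)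
qed

abbreviation summand :: "nat \<Rightarrow> (free_alg set, nat \<Rightarrow> complex) module" where
  "summand l \<equiv> simple_module q (s l) (m l)"

lemma carrier_direct_sum:
  "x \<in> carrier (direct_sum {0..v} summand) \<longleftrightarrow>
    x \<in> extensional {0..v} \<and> (\<forall>l\<le>v. \<forall>k>m l. x l k = 0)"
  by (auto simp: direct_sum_def PiE_def Pi_def simple_module_def)

lemma decomposition:
  "left_module_iso (uq q n) (tensor_module q n V W) (direct_sum {0..v} summand)"
proof (rule left_module_iso_transport[where g = "\<lambda>x. tensor_class (assemble x)"])
  let ?S = "direct_sum {0..v} summand"
  show "left_module (uq q n) ?S"
    by (rule left_module_direct_sum[OF ring_uq]) (simp add: left_module_simple[OF m_le cong_m])
  have "inj_on assemble (carrier ?S)"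
  proof (rule inj_onI)
    fix x y assume x: "x \<in> carrier ?S" and y: "y \<in> carrier ?S" and eq: "assemble x = assemble y"
    have "assemble (\<lambda>l k. x l k + -1 * y l k) = (\<lambda>p. 0)"
      unfolding assemble_add assemble_scale using eq by simp
    then have "x l k = y l k" if "l \<le> v" "k \<le> m l" for l k
      using assemble_injective[OF _ that, of "\<lambda>l k. x l k + -1 * y l k"] by simp
    then have "x l k = y l k" if "l \<le> v" for l k
      using x y that by (cases "k \<le> m l") (auto simp: carrier_direct_sum)
    then have "x l = y l" if "l \<in> {0..v}" for l
      using that by auto
    then show "x = y"
      using x y by (intro extensionalityI[of x "{0..v}" y]) (auto simp: carrier_direct_sum)
  qed
  then have "inj_on (\<lambda>x. tensor_class (assemble x)) (carrier ?S)"
    using inj_tensor_class assemble_closed by (auto simp: inj_on_def)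
  moreover have "(\<lambda>x. tensor_class (assemble x)) ` carrier ?S = carrier (tensor_module q n V W)"
    unfolding carrier_tensor_module
  proof (intro Set.set_eqI iffI)
    fix Z assume "Z \<in> tensor_class ` tensor_vectors"
    then obtain x where Z: "Z = tensor_class (assemble x)"
      using assemble_surjective by blast
    \<comment> \<open>\<open>assemble\<close> ignores entries outside the index ranges, so they may be reset.\<close>
    let ?x = "\<lambda>l\<in>{0..v}. \<lambda>k. if k \<le> m l then x l k else 0"
    have "assemble ?x = assemble x"
      by (simp add: assemble_def)
    moreover have "?x \<in> carrier ?S"
      by (simp add: carrier_direct_sum)
    ultimately show "Z \<in> (\<lambda>x. tensor_class (assemble x)) ` carrier ?S"
      using Z by (metis (no_types, lifting) image_eqI)
  qed (use assemble_closed in auto)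
  ultimately show "bij_betw (\<lambda>x. tensor_class (assemble x)) (carrier ?S)
      (carrier (tensor_module q n V W))"
    by (simp add: bij_betw_def)
  show "tensor_class (assemble x) \<oplus>\<^bsub>tensor_module q n V W\<^esub> tensor_class (assemble y) =
      tensor_class (assemble (x \<oplus>\<^bsub>?S\<^esub> y))" for x y
  proof -
    have "assemble (x \<oplus>\<^bsub>?S\<^esub> y) = assemble (\<lambda>l k. x l k + y l k)"
      by (rule assemble_cong) (simp add: direct_sum_def simple_module_def)
    then show ?thesis
      by (simp add: add_tensor_class assemble_closed assemble_add)
  qed
  have "assemble \<zero>\<^bsub>?S\<^esub> = assemble (\<lambda>l k. 0)"
    by (rule assemble_cong) (simp add: direct_sum_def simple_module_def)
  then show "\<zero>\<^bsub>tensor_module q n V W\<^esub> = tensor_class (assemble \<zero>\<^bsub>?S\<^esub>)"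
    by (simp add: zero_tensor_module assemble_zero)
  fix A x assume A: "A \<in> carrier (uq q n)" and x: "x \<in> carrier ?S"
  obtain a where a: "A = uq_class q n a"
    using A by (auto simp: carrier_uq)
  have xl: "\<forall>k>m l. x l k = 0" if "l \<le> v" for l
    using x that by (simp add: carrier_direct_sum)
  have "assemble (A \<odot>\<^bsub>?S\<^esub> x) = assemble (\<lambda>l. simple_op q (s l) (m l) a (x l))"
    by (rule assemble_cong) (simp add: direct_sum_def a simple_smult[OF m_le cong_m xl])
  moreover have "act_ext (foldr gen_op) b (assemble x) =
      assemble (\<lambda>l. simple_op q (s l) (m l) a (x l))" if "b \<in> uq_class q n a" for b
    unfolding assemble_act[symmetric]
    by (rule assemble_cong) (rule simple_op_class[OF m_le cong_m xl that])
  ultimately show "A \<odot>\<^bsub>tensor_module q n V W\<^esub> tensor_class (assemble x) =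
      tensor_class (assemble (A \<odot>\<^bsub>?S\<^esub> x))"
    unfolding a by (simp add: smult_tensor_class[OF assemble_closed])
qed

end

theorem theorem5p1:
  fixes q :: complex and n d u v :: nat and i j :: int
  assumes "n \<ge> 3" and "n \<noteq> 4" and "primitive_root_of_unity n q"
    and "d = ord_d n"
    and "u \<le> d - 1" and "[int u = - 2 * i] (mod int d)"
    and "v \<le> d - 1" and "[int v = - 2 * j] (mod int d)"
    and "u + v \<le> d - 1" and "v \<le> u"
  shows "left_module_iso (uq q n)
           (tensor_module q n (simple_module q i u) (simple_module q j v))
           (direct_sum {0..v} (\<lambda>l. simple_module q (i + j + int l) (u + v - 2 * l)))"
proof -
  interpret small_pair q n u v i j
    using assms by unfold_locales auto
  show ?thesis by (rule decomposition)
qed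

end
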